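(* Let $f_{0}\in\mathfrak{C}_{2}$, let $x_{0}\ge 1$, and let $\delta\in(-\delta_{-},\delta_{+})$, for some small $\delta_{\pm}>0$. Consider the problem $$(P)\qquad \min\{\|f-f_{0}\|_{2}^{2}:\ f\in\mathfrak{C}_{2},\ f(x_{0})-f_{0}(x_{0})=\delta\}.$$ The minimizer $\sigma_{*}$ in $(P)$ exists and is unique and has either a finite support or a countable support $\{t_{n}:n\ge 1\}$ with $$(S)\qquad \sum_{n=1}^{\infty}\frac{1}{t_{n}}<\infty.$$ In either case $$(I)\qquad C(t)\ge\frac{e^{-x_{0}t}}{f_{0}(x_{0})+\delta}\int_{0}^{1}f_{\sigma_{*}}(x)\,(f_{\sigma_{*}}(x)-f_{0}(x))\,dx,\qquad t\ge 0,$$ with equality at all $t=t_{n}$ in the support of $\sigma_{*}$. Conversely, if $\sigma_{*}$ is a positive measure, whose support $\{t_{n}:n\ge 1\}$ satisfies $(S)$, and is such that $(I)$ holds, then it is a minimizer in $(P)$, provided $\sigma_{*}\neq\sigma_{0}$, where $f_{\sigma_{0}}=f_{0}$.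
   Context: For a positive, Borel-regular measure $\sigma$ on $[0,\infty)$ write $f_{\sigma}(x)=\int_{0}^{\infty}e^{-xt}\,d\sigma(t)$. The class CM of completely monotone functions consists of all such $f_{\sigma}$ with $f_{\sigma}(x)<\infty$ for all $x>0$. $\|\cdot\|_{2}$ denotes the $L^{2}(0,1)$ norm, and $\mathfrak{C}_{2}=\{f\in\mathrm{CM}:\|f\|_{2}<\infty\}$. A function in $\mathfrak{C}_{2}$ is identified with its representing measure, so that "$\sigma_{*}$ is a minimizer in $(P)$" means that $f_{\sigma_{*}}$ satisfies the constraint $f_{\sigma_{*}}(x_{0})-f_{0}(x_{0})=\delta$ and minimizes $\|f_{\sigma}-f_{0}\|_{2}^{2}$ among all $f_{\sigma}\in\mathfrak{C}_{2}$ satisfying it. The function $C$ (the Caprini function) is defined from $\sigma_{*}$ by $C(t)=\int_{0}^{1}e^{-xt}(f_{\sigma_{*}}(x)-f_{0}(x))\,dx$.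
   Formalization: The support claim is made only for δ≠0 (at δ=0 the minimizer is σ_0, which is arbitrary); if f_0=0, δ>0 is required; in the converse, (I) includes equality on the support and f_{σ_*}∈C_2 is assumed; a support point t=0 is left out of the sum (S). *)

theory Defs
  imports "HOL-Analysis.Analysis"
begin

definition laplace :: "real measure \<Rightarrow> real \<Rightarrow> real" where
  "laplace \<sigma> x = (\<integral>t. exp (- (x * t)) \<partial>\<sigma>)"

text \<open>
  Borel measures on the half-line for which \<open>laplace \<sigma> x\<close> is finite for all \<open>x > 0\<close>.
  Finiteness is required as integrability, because the Bochner integral of a
  non-integrable function is 0. It makes \<open>\<sigma>\<close> finite on bounded sets, hence regular,
  so regularity is not a separate condition.
\<close>
definition CM_measure :: "real measure \<Rightarrow> bool" where
  "CM_measure \<sigma> \<longleftrightarrow> sets \<sigma> = sets (restrict_space borel {0..}) \<and>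
     (\<forall>x>0. integrable \<sigma> (\<lambda>t. exp (- (x * t))))"

text \<open>Functions on \<open>(0,\<infinity>)\<close> are total functions whose values outside \<open>(0,\<infinity>)\<close> are irrelevant.\<close>
definition represents :: "real measure \<Rightarrow> (real \<Rightarrow> real) \<Rightarrow> bool" where
  "represents \<sigma> f \<longleftrightarrow> CM_measure \<sigma> \<and> (\<forall>x>0. f x = laplace \<sigma> x)"

definition CM :: "(real \<Rightarrow> real) set" where
  "CM = {f. \<exists>\<sigma>. represents \<sigma> f}"

definition norm_L2 :: "(real \<Rightarrow> real) \<Rightarrow> real" where
  "norm_L2 f = sqrt (LBINT x:{0<..<1}. (f x)\<^sup>2)"

text \<open>The integrability condition says that the \<open>L\<^sup>2(0,1)\<close> norm is finite.\<close>
definition C2 :: "(real \<Rightarrow> real) set" where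
  "C2 = {f \<in> CM. set_integrable lborel {0<..<1} (\<lambda>x. (f x)\<^sup>2)}"

definition feasible :: "(real \<Rightarrow> real) \<Rightarrow> real \<Rightarrow> real \<Rightarrow> (real \<Rightarrow> real) set" where
  "feasible f0 x0 \<delta> = {f \<in> C2. f x0 - f0 x0 = \<delta>}"

definition is_minimizer :: "(real \<Rightarrow> real) \<Rightarrow> real \<Rightarrow> real \<Rightarrow> real measure \<Rightarrow> bool" where
  "is_minimizer f0 x0 \<delta> \<sigma> \<longleftrightarrow>
     CM_measure \<sigma> \<and> laplace \<sigma> \<in> feasible f0 x0 \<delta> \<and>
     (\<forall>f \<in> feasible f0 x0 \<delta>.
        (norm_L2 (\<lambda>x. laplace \<sigma> x - f0 x))\<^sup>2 \<le> (norm_L2 (\<lambda>x. f x - f0 x))\<^sup>2)"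

text \<open>Topological support of a measure on \<open>[0,\<infinity>)\<close>.\<close>
definition msupport :: "real measure \<Rightarrow> real set" where
  "msupport \<sigma> = {t \<in> {0..}. \<forall>U. open U \<and> t \<in> U \<longrightarrow> emeasure \<sigma> (U \<inter> {0..}) > 0}"

text \<open>
  The support is finite, or it is enumerated without repetition as \<open>{t n | n \<ge> 1}\<close> with a
  convergent sum of reciprocals. The support may contain the point 0; since \<open>1 / 0 = 0\<close>,
  that point contributes nothing to the sum.
\<close>
definition finite_or_S_support :: "real measure \<Rightarrow> bool" where
  "finite_or_S_support \<sigma> \<longleftrightarrow> finite (msupport \<sigma>) \<or>
     (\<exists>t::nat \<Rightarrow> real. bij_betw t {1..} (msupport \<sigma>) \<and> summable (\<lambda>n. 1 / t (Suc n)))"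

definition caprini :: "(real \<Rightarrow> real) \<Rightarrow> real measure \<Rightarrow> real \<Rightarrow> real" where
  "caprini f0 \<sigma> t = (LBINT x:{0<..<1}. exp (- (x * t)) * (laplace \<sigma> x - f0 x))"

definition caprini_bound ::
  "(real \<Rightarrow> real) \<Rightarrow> real \<Rightarrow> real \<Rightarrow> real measure \<Rightarrow> real \<Rightarrow> real" where
  "caprini_bound f0 x0 \<delta> \<sigma> t =
     exp (- (x0 * t)) / (f0 x0 + \<delta>) *
     (LBINT x:{0<..<1}. laplace \<sigma> x * (laplace \<sigma> x - f0 x))"

definition caprini_condition ::
  "(real \<Rightarrow> real) \<Rightarrow> real \<Rightarrow> real \<Rightarrow> real measure \<Rightarrow> bool" where
  "caprini_condition f0 x0 \<delta> \<sigma> \<longleftrightarrow>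
     (\<forall>t\<ge>0. caprini f0 \<sigma> t \<ge> caprini_bound f0 x0 \<delta> \<sigma> t) \<and>
     (\<forall>t\<in>msupport \<sigma>. caprini f0 \<sigma> t = caprini_bound f0 x0 \<delta> \<sigma> t)"

end

theory Submission
  imports Defs "HOL-Probability.Probability" "HOL-Complex_Analysis.Complex_Analysis"
    "HOL-Real_Asymp.Real_Asymp"
begin

text \<open>
  Put \<open>c = f0 x0 + \<delta>\<close>, the value that a competitor has to take at \<open>x0\<close>. It is positive for all
  admitted \<open>\<delta>\<close>: either \<open>f0 x0 > 0\<close> and \<open>\<delta> > - f0 x0\<close>, or \<open>f0 x0 = 0\<close>, in which case \<open>\<sigma>0\<close> is the null
  measure, \<open>f0\<close> vanishes identically and \<open>\<delta> > 0\<close> is assumed.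

  Existence (\<open>minimizer_exists\<close>): a decreasing function \<open>f\<close> satisfies \<open>x (f x)\<^sup>2 \<le> \<parallel>f\<parallel>\<^sup>2\<close>, so the
  members of a minimizing sequence are bounded at every point \<open>x > 0\<close>. The probability measures
  with density \<open>exp (- x0 t) / c\<close> are then tight, because values at points below \<open>x0\<close> are
  exponential moments. Helly selection gives a limit measure, boundedness of a higher exponential
  moment carries the convergence to the Laplace transforms at all \<open>x \<le> x0\<close>, hence to the
  constraint, and Fatou's lemma shows that the limit is optimal.

  Optimality is equivalent to a variational inequality, because the problem is convex
  (\<open>optimal_iff_variational\<close>). If there are two minimizers, the inequality at one of them, tested
  with the other, shows together with the equality of their misfits that their transforms have
  distance 0 in \<open>L\<^sup>2(0,1)\<close>; uniqueness follows since the transform on \<open>(0,1)\<close> determines the measure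
  (\<open>laplace_unique\<close>: analytic continuation to a vertical line, where the transform is a
  characteristic function). Testing the inequality with the exponentials
  \<open>c exp (x0 t) exp (- x t)\<close> is exactly the Caprini inequality (I), and integrating (I) against
  the minimizer gives equality of the integrals, hence equality on the support.

  For the support (\<open>optimal_support\<close>), the difference of the two sides of (I) is an entire function
  of \<open>t\<close> that is bounded on \<open>Re t > -1\<close>. Zeros of such a function satisfy the Blaschke condition,
  which for zeros \<open>t \<ge> 0\<close> says that \<open>1 / (1 + t)\<close> is summable over them, unless the function
  vanishes identically. In that case (I) is an equality for all real \<open>t\<close>, and \<open>t \<rightarrow> -\<infinity>\<close> forces
  both sides to be 0 because \<open>x0 \<ge> 1\<close>; then the residual is orthogonal to itself and \<open>\<delta> = 0\<close>.

  Conversely (\<open>caprini_condition_imp_optimal\<close>), let \<open>I\<close> be the inner product of \<open>f\<close> and \<open>f - f0\<close>.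
  Integrating the equality on the support against \<open>\<sigma>\<close> gives \<open>I = I f(x0) / c\<close>. If \<open>I \<noteq> 0\<close>, this is
  the constraint, and integrating (I) against any competitor is the variational inequality. If
  \<open>I = 0\<close>, integrating (I) against \<open>\<sigma>0\<close> gives \<open>\<parallel>f - f0\<parallel>\<^sup>2 \<le> 0\<close>, so \<open>\<sigma> = \<sigma>0\<close>.
\<close>

section \<open>Holomorphic functions given by Laplace integrals, and their zeros\<close>

text \<open>
  The integrand is expanded as a power series in \<open>z - a\<close>. Its partial sums are dominated by the
  integrable function \<open>exp (\<bar>z - a\<bar> \<bar>t\<bar>) \<bar>w t\<bar>\<close>, so the integral is a power series as well.
\<close>
lemma holomorphic_exp_integral:
  fixes M :: "real measure" and w :: "real \<Rightarrow> real"
  assumes id_meas [measurable]: "(\<lambda>t. t) \<in> borel_measurable M"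
    and w_meas [measurable]: "w \<in> borel_measurable M"
    and int: "\<And>r. 0 \<le> r \<Longrightarrow> r < R \<Longrightarrow> integrable M (\<lambda>t. exp (r * \<bar>t\<bar>) * \<bar>w t\<bar>)"
  shows "(\<lambda>z. \<integral>t. exp (- ((z - a) * of_real t)) * of_real (w t) \<partial>M) holomorphic_on ball (a::complex) R"
proof (rule power_series_holomorphic)
  fix z assume z: "z \<in> ball a R"
  define u where "u = (\<lambda>n t. (- ((z - a) * of_real t)) ^ n /\<^sub>R fact n * complex_of_real (w t))"
  have r: "norm (z - a) < R" using z by (simp add: dist_norm norm_minus_commute)
  note I = int[OF norm_ge_zero r]
  have u_bd: "norm (\<Sum>n<k. u n t) \<le> exp (norm (z - a) * \<bar>t\<bar>) * \<bar>w t\<bar>" for k t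
  proof -
    have "norm (\<Sum>n<k. u n t) \<le> (\<Sum>n<k. (norm (z - a) * \<bar>t\<bar>) ^ n /\<^sub>R fact n) * \<bar>w t\<bar>"
      by (rule order_trans[OF norm_sum])
         (simp add: u_def sum_distrib_right norm_mult norm_power mult.assoc)
    also have "(\<Sum>n<k. (norm (z - a) * \<bar>t\<bar>) ^ n /\<^sub>R fact n) \<le> exp (norm (z - a) * \<bar>t\<bar>)"
      unfolding exp_def by (rule sum_le_suminf[OF summable_exp_generic]) auto
    finally show ?thesis by (simp add: mult_right_mono)
  qed
  have u_meas [measurable]: "u n \<in> borel_measurable M" for n
    unfolding u_def by measurable
  have u_int: "integrable M (u n)" for n
  proof (rule Bochner_Integration.integrable_bound[OF I u_meas])
    have "norm (u n t) \<le> exp (norm (z - a) * \<bar>t\<bar>) * \<bar>w t\<bar>" for t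
    proof -
      have "(norm (z - a) * \<bar>t\<bar>) ^ n /\<^sub>R fact n \<le> exp (norm (z - a) * \<bar>t\<bar>)"
        using sum_le_suminf[OF summable_exp_generic[of "norm (z - a) * \<bar>t\<bar>"], of "{n}"]
        unfolding exp_def by simp
      from mult_right_mono[OF this, of "\<bar>w t\<bar>"] show ?thesis
        by (simp add: u_def norm_mult norm_power)
    qed
    then show "AE t in M. norm (u n t) \<le> norm (exp (norm (z - a) * \<bar>t\<bar>) * \<bar>w t\<bar>)"
      by (intro AE_I2) (auto intro: order_trans)
  qed
  have "(\<lambda>k. \<integral>t. (\<Sum>n<k. u n t) \<partial>M)
      \<longlonglongrightarrow> (\<integral>t. exp (- ((z - a) * of_real t)) * of_real (w t) \<partial>M)"
  proof (rule integral_dominated_convergence[OF _ _ I])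
    have "(\<lambda>n. u n t) sums (exp (- ((z - a) * of_real t)) * of_real (w t))" for t
      unfolding u_def by (intro sums_mult2 exp_converges)
    then show "AE t in M. (\<lambda>k. \<Sum>n<k. u n t) \<longlonglongrightarrow> exp (- ((z - a) * of_real t)) * of_real (w t)"
      by (auto simp: sums_def)
  qed (use u_bd in auto)
  then have "(\<lambda>n. integral\<^sup>L M (u n)) sums (\<integral>t. exp (- ((z - a) * of_real t)) * of_real (w t) \<partial>M)"
    using u_int by (simp add: sums_def)
  moreover have "integral\<^sup>L M (u n) =
      (\<integral>t. (- of_real t) ^ n /\<^sub>R fact n * complex_of_real (w t) \<partial>M) * (z - a) ^ n" for n
  proof -
    have "u n t = (- of_real t) ^ n /\<^sub>R fact n * complex_of_real (w t) * (z - a) ^ n" for t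
      unfolding u_def using power_mult_distrib[of "- of_real t" "z - a" n] by (simp add: mult_ac)
    then have "u n = (\<lambda>t. (- of_real t) ^ n /\<^sub>R fact n * complex_of_real (w t) * (z - a) ^ n)"
      by (rule ext)
    then show ?thesis by (simp only: integral_mult_left_zero)
  qed
  ultimately show "(\<lambda>n. (\<integral>t. (- of_real t) ^ n /\<^sub>R fact n * complex_of_real (w t) \<partial>M) * (z - a) ^ n) sums
      (\<integral>t. exp (- ((z - a) * of_real t)) * of_real (w t) \<partial>M)"
    by simp
qed

text \<open>
  The Schwarz lemma, transported from the disc by the Cayley map that sends 0 to the zero \<open>p\<close>.
\<close>
lemma Schwarz_half_plane:
  fixes h :: "complex \<Rightarrow> complex" and p :: real
  assumes holo: "h holomorphic_on {z. Re z > 0}"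
    and bd: "\<And>z. Re z > 0 \<Longrightarrow> norm (h z) \<le> B"
    and p: "p > 0" "h (of_real p) = 0" and z: "Re z > 0"
  shows "norm (h z) \<le> B * (norm (z - of_real p) / norm (z + of_real p))"
proof -
  define w where "w = (z - of_real p) / (z + of_real p)"
  define \<phi> where "\<phi> = (\<lambda>w. of_real p * (1 + w) / (1 - w) :: complex)"
  have zp: "z + of_real p \<noteq> 0" using z p by (auto simp: complex_eq_iff)
  have w1: "norm w < 1"
  proof -
    have "(norm (z - of_real p))\<^sup>2 < (norm (z + of_real p))\<^sup>2"
      using mult_pos_pos[OF z p(1)] unfolding cmod_power2 by (simp add: power2_eq_square algebra_simps)
    then have "norm (z - of_real p) < norm (z + of_real p)"
      by (rule power2_less_imp_less) simp
    then show ?thesis by (simp add: w_def norm_divide divide_less_eq zp)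
  qed
  have Re_phi: "Re (\<phi> v) > 0" if "norm v < 1" for v
  proof -
    have "v \<noteq> 1" using that by auto
    then have "(1 - Re v)\<^sup>2 + (Im v)\<^sup>2 > 0"
      by (auto simp: complex_eq_iff sum_power2_gt_zero_iff)
    moreover have "(Re v)\<^sup>2 + (Im v)\<^sup>2 < 1"
      using that by (simp add: cmod_def)
    moreover have "Re (\<phi> v) = p * (1 - ((Re v)\<^sup>2 + (Im v)\<^sup>2)) / ((1 - Re v)\<^sup>2 + (Im v)\<^sup>2)"
      unfolding \<phi>_def Re_divide by (simp add: power2_eq_square algebra_simps)
    ultimately show ?thesis using p by simp
  qed
  have phi_w: "\<phi> w = z"
  proof -
    have "1 - w = 2 * of_real p / (z + of_real p)" "1 + w = 2 * z / (z + of_real p)"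
      using zp by (auto simp: w_def field_simps)
    then show ?thesis using zp p by (simp add: \<phi>_def)
  qed
  have B0: "B \<ge> 0" using bd[OF z] norm_ge_zero order_trans by blast
  \<comment> \<open>The Schwarz lemma needs a strict bound, which \<open>B + e\<close> provides.\<close>
  have "norm (h z) \<le> B * norm w + e" if "e > 0" for e
  proof -
    have "norm (h (\<phi> w) / of_real (B + e)) \<le> norm w"
    proof (rule Schwarz_Lemma(1))
      show "(\<lambda>w. h (\<phi> w) / of_real (B + e)) holomorphic_on ball 0 1"
      proof (intro holomorphic_intros)
        show "of_real (B + e) \<noteq> (0::complex)" using B0 that by (metis add_nonneg_pos less_irrefl of_real_eq_0_iff)
        show "(\<lambda>w. h (\<phi> w)) holomorphic_on ball 0 1"
        proof (rule holomorphic_on_compose_gen[OF _ holo, unfolded o_def])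
          show "\<phi> holomorphic_on ball 0 1"
            unfolding \<phi>_def by (intro holomorphic_intros) auto
        qed (use Re_phi in auto)
      qed
      show "h (\<phi> 0) / of_real (B + e) = 0" using p by (simp add: \<phi>_def)
      show "norm (h (\<phi> v) / of_real (B + e)) < 1" if "norm v < 1" for v
        using bd[OF Re_phi[OF that]] B0 \<open>e > 0\<close>
        by (simp add: norm_divide divide_less_eq del: of_real_add)
    qed (rule w1)
    then have "norm (h z) \<le> (B + e) * norm w"
      using B0 that by (simp add: phi_w norm_divide divide_le_eq mult.commute del: of_real_add)
    also have "\<dots> \<le> B * norm w + e"
      using that w1 by (simp add: algebra_simps)
    finally show ?thesis .
  qed
  then have "norm (h z) \<le> B * norm w" by (rule field_le_epsilon)
  then show ?thesis by (simp add: w_def norm_divide)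
qed

text \<open>
  Dividing \<open>h\<close> by the factor \<open>(z - p) / (z + p)\<close> removes one zero, and by \<open>Schwarz_half_plane\<close> the
  quotient satisfies the same bound \<open>B\<close>. Hence the zeros can be split off one at a time.
\<close>
lemma Blaschke_bound:
  fixes h :: "complex \<Rightarrow> complex" and F :: "real set"
  assumes "finite F" and "F \<subseteq> {0<..}"
    and "h holomorphic_on {z. Re z > 0}"
    and "\<And>z. Re z > 0 \<Longrightarrow> norm (h z) \<le> B"
    and "\<And>p. p \<in> F \<Longrightarrow> h (of_real p) = 0" and "Re z > 0"
  shows "norm (h z) \<le> B * (\<Prod>p\<in>F. norm (z - of_real p) / norm (z + of_real p))"
  using assms
proof (induction F arbitrary: h rule: finite_induct)
  case empty
  then show ?case by simp
next
  case (insert p F)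
  let ?S = "{z. Re z > 0}"
  have opS: "open ?S" by (simp add: open_halfspace_Re_gt)
  have p: "p > 0" "h (of_real p) = 0" using insert.prems by auto
  define q where "q = (\<lambda>z. (if z = of_real p then deriv h (of_real p)
      else (h z - h (of_real p)) / (z - of_real p)) * (z + of_real p))"
  have q_eq: "h z = q z * ((z - of_real p) / (z + of_real p))" if "Re z > 0" for z
  proof (cases "z = of_real p")
    case False
    have "z + of_real p \<noteq> 0" using that p by (auto simp: complex_eq_iff)
    with False show ?thesis by (simp add: q_def p)
  qed (simp add: p)
  have q_holo: "q holomorphic_on ?S"
    unfolding q_def by (intro holomorphic_intros pole_lemma_open insert.prems opS)
  have q_le: "norm (q z) \<le> B" if "Re z > 0" "z \<noteq> of_real p" for z
  proof -
    have "norm (q z) * (norm (z - of_real p) / norm (z + of_real p))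
        \<le> B * (norm (z - of_real p) / norm (z + of_real p))"
      using Schwarz_half_plane[OF insert.prems(2,3) p that(1)] q_eq[OF that(1)]
      by (simp add: norm_mult norm_divide)
    moreover have "z + of_real p \<noteq> 0" using that p by (auto simp: complex_eq_iff)
    ultimately show ?thesis using that(2)
      by (metis divide_pos_pos mult_le_cancel_right_pos right_minus_eq zero_less_norm_iff)
  qed
  have q_le': "norm (q z) \<le> B" if "Re z > 0" for z
  proof (cases "z = of_real p")
    case True
    have "isCont q (of_real p)"
      using holomorphic_on_imp_continuous_on[OF q_holo] opS p by (simp add: continuous_on_eq_continuous_at)
    then have "((\<lambda>z. norm (q z)) \<longlongrightarrow> norm (q (of_real p))) (at (of_real p))"
      by (intro tendsto_norm) (simp add: isCont_def)
    moreover have "\<forall>\<^sub>F z in at (of_real p). norm (q z) \<le> B"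
      using eventually_at_in_open[OF opS, of "of_real p"] p
      by (auto elim!: eventually_mono intro!: q_le)
    ultimately show ?thesis using tendsto_upperbound True by force
  qed (use q_le that in auto)
  have q0: "q (of_real p') = 0" if "p' \<in> F" for p'
  proof -
    have "p' > 0" "p' \<noteq> p" "h (of_real p') = 0" using that insert by auto
    then show ?thesis by (simp add: q_def p)
  qed
  have "norm (q z) \<le> B * (\<Prod>p\<in>F. norm (z - of_real p) / norm (z + of_real p))"
    using insert.prems(1,5) q_le' q0 by (intro insert.IH q_holo) auto
  then have "norm (q z) * (norm (z - of_real p) / norm (z + of_real p))
      \<le> B * (\<Prod>p\<in>F. norm (z - of_real p) / norm (z + of_real p)) * (norm (z - of_real p) / norm (z + of_real p))"
    by (rule mult_right_mono) simp
  then show ?case using insert.hyps q_eq[OF insert.prems(5)]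
    by (simp add: norm_mult norm_divide mult_ac)
qed

text \<open>
  The Blaschke condition for nonnegative zeros. The half-plane is moved to \<open>Re z > -1\<close> so that zeros
  near 0 stay away from its boundary; they are thereby kept from accumulating at 0. Each Blaschke factor at
  \<open>s\<close> is at most \<open>exp (- 2 / ((s + 2) (1 + t)))\<close>, and their product is at least \<open>\<bar>g s\<bar> / B\<close>.
\<close>
lemma sum_zeros_half_plane_bound:
  fixes g :: "complex \<Rightarrow> complex"
  assumes holo: "g holomorphic_on {z. Re z > -1}"
    and bd: "\<And>z. Re z > -1 \<Longrightarrow> norm (g z) \<le> B"
    and s: "s \<ge> 0" "g (of_real s) \<noteq> 0"
    and F: "finite F" "\<And>t. t \<in> F \<Longrightarrow> t \<ge> 0 \<and> g (of_real t) = 0"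
  shows "(\<Sum>t\<in>F. 1 / (1 + t)) \<le> (s + 2) / 2 * ln (B / norm (g (of_real s)))"
proof -
  have inj: "inj_on (\<lambda>t::real. t + 1) F" by (simp add: inj_on_def)
  have "norm (g (of_real (s + 1) - 1)) \<le>
      B * (\<Prod>p\<in>(\<lambda>t. t + 1) ` F. norm (complex_of_real (s + 1) - of_real p) / norm (complex_of_real (s + 1) + of_real p))"
  proof (rule Blaschke_bound[where h = "\<lambda>z. g (z - 1)"])
    show "(\<lambda>z. g (z - 1)) holomorphic_on {z. 0 < Re z}"
      by (rule holomorphic_on_compose_gen[OF _ holo, unfolded o_def])
         (auto intro!: holomorphic_intros)
  qed (use F s bd in force)+
  also have "\<dots> = B * (\<Prod>t\<in>F. \<bar>s - t\<bar> / (s + t + 2))"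
  proof -
    have "norm (complex_of_real (s + 1) - of_real (t + 1)) / norm (complex_of_real (s + 1) + of_real (t + 1))
        = \<bar>s - t\<bar> / (s + t + 2)" if "t \<in> F" for t
    proof -
      have "complex_of_real (s + 1) - of_real (t + 1) = of_real (s - t)"
        "complex_of_real (s + 1) + of_real (t + 1) = of_real (s + t + 2)" by simp_all
      then show ?thesis using F(2)[OF that] s by (simp only: norm_of_real) simp
    qed
    then show ?thesis by (simp add: prod.reindex[OF inj] cong: prod.cong)
  qed
  also have "\<dots> \<le> B * (\<Prod>t\<in>F. exp (- (2 / (s + 2) * (1 / (1 + t)))))"
  proof (intro mult_left_mono prod_mono conjI)
    fix t assume t: "t \<in> F"
    have t0: "t \<ge> 0" using F(2)[OF t] by simp
    have "2 / (s + 2) * (1 / (1 + t)) \<le> 2 * (1 + min s t) / (s + t + 2)"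
    proof -
      have "2 / (s + 2) * (1 / (1 + t)) = 2 / ((s + 2) * (1 + t))" by simp
      also have "\<dots> \<le> 2 / (s + t + 2)"
        using t0 s mult_nonneg_nonneg[OF s(1) t0]
        by (intro divide_left_mono mult_pos_pos) (auto simp: algebra_simps)
      also have "\<dots> \<le> 2 * (1 + min s t) / (s + t + 2)"
        using t0 s by (intro divide_right_mono) auto
      finally show ?thesis .
    qed
    moreover have "\<bar>s - t\<bar> / (s + t + 2) = 1 - 2 * (1 + min s t) / (s + t + 2)"
      using t0 s by (simp add: field_simps min_def abs_if)
    ultimately have "\<bar>s - t\<bar> / (s + t + 2) \<le> 1 - 2 / (s + 2) * (1 / (1 + t))" by linarith
    also have "\<dots> \<le> exp (- (2 / (s + 2) * (1 / (1 + t))))"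
      using exp_ge_add_one_self[of "- (2 / (s + 2) * (1 / (1 + t)))"] by linarith
    finally show "\<bar>s - t\<bar> / (s + t + 2) \<le> exp (- (2 / (s + 2) * (1 / (1 + t))))" .
    show "0 \<le> \<bar>s - t\<bar> / (s + t + 2)" using t0 s by simp
  next
    show "0 \<le> B" using bd[of "of_real s"] s by (auto intro: order_trans[OF norm_ge_zero])
  qed
  also have "\<dots> = B * exp (- (2 / (s + 2) * (\<Sum>t\<in>F. 1 / (1 + t))))"
    by (simp add: exp_sum[OF F(1), symmetric] sum_negf sum_distrib_left)
  finally have *: "norm (g (of_real s)) \<le> B * exp (- (2 / (s + 2) * (\<Sum>t\<in>F. 1 / (1 + t))))"
    by simp
  have g0: "norm (g (of_real s)) > 0" using s by simp
  also have "norm (g (of_real s)) \<le> B" using bd[of "of_real s"] s by simp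
  finally have B: "B > 0" .
  have "exp (2 / (s + 2) * (\<Sum>t\<in>F. 1 / (1 + t))) \<le> B / norm (g (of_real s))"
    using * g0 by (simp add: exp_minus field_simps)
  then have "2 / (s + 2) * (\<Sum>t\<in>F. 1 / (1 + t)) \<le> ln (B / norm (g (of_real s)))"
    using B g0 by (simp add: ln_ge_iff)
  then show ?thesis using s by (simp add: field_simps)
qed

section \<open>Measures of completely monotone functions\<close>

lemma CM_measure_sets: "CM_measure \<sigma> \<Longrightarrow> sets \<sigma> = sets (restrict_space borel {0..})"
  by (simp add: CM_measure_def)

lemma CM_measure_space: "CM_measure \<sigma> \<Longrightarrow> space \<sigma> = {0..}"
  by (simp add: CM_measure_sets[THEN sets_eq_imp_space_eq] space_restrict_space)

lemma CM_measure_measurable: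
  "CM_measure \<sigma> \<Longrightarrow> f \<in> measurable borel N \<Longrightarrow> f \<in> measurable \<sigma> N"
  by (simp add: measurable_restrict_space1 cong: measurable_cong_sets[OF CM_measure_sets])

lemma CM_measure_integrable:
  "CM_measure \<sigma> \<Longrightarrow> x > 0 \<Longrightarrow> integrable \<sigma> (\<lambda>t. exp (- (x * t)))"
  by (simp add: CM_measure_def)

lemma CM_measure_AE_nonneg: "CM_measure \<sigma> \<Longrightarrow> AE t in \<sigma>. t \<ge> 0"
  by (rule AE_I2) (simp add: CM_measure_space)

lemma CM_measure_sigma_finite:
  assumes "CM_measure \<sigma>"
  shows "sigma_finite_measure \<sigma>"
proof
  have "emeasure \<sigma> {0..real n} \<noteq> \<infinity>" for n
  proof -
    have A: "{0..real n} \<in> sets \<sigma>"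
      by (simp add: CM_measure_sets[OF assms] sets_restrict_space_iff)
    have "integrable \<sigma> (indicator {0..real n} :: real \<Rightarrow> real)"
    proof (rule Bochner_Integration.integrable_bound)
      show "integrable \<sigma> (\<lambda>t. exp (real n) * exp (- (1 * t)))"
        using CM_measure_integrable[OF assms, of 1] by (intro integrable_mult_right) auto
      show "AE t in \<sigma>. norm (indicat_real {0..real n} t) \<le> norm (exp (real n) * exp (- (1 * t)))"
        by (auto simp: indicator_def simp flip: exp_add)
    qed (use A in auto)
    then show ?thesis using A by (simp add: integrable_indicator_iff less_top Int_absorb2[OF sets.sets_into_space])
  qed
  then have "countable (range (\<lambda>n. {0..real n}))"
    "range (\<lambda>n. {0..real n}) \<subseteq> sets \<sigma>" "\<Union> (range (\<lambda>n. {0..real n})) = space \<sigma>"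
    "\<forall>a\<in>range (\<lambda>n. {0..real n}). emeasure \<sigma> a \<noteq> \<infinity>"
    by (auto simp: CM_measure_space[OF assms] CM_measure_sets[OF assms] sets_restrict_space_iff
        intro: real_arch_simple)
  then show "\<exists>A. countable A \<and> A \<subseteq> sets \<sigma> \<and> \<Union> A = space \<sigma> \<and> (\<forall>a\<in>A. emeasure \<sigma> a \<noteq> \<infinity>)"
    by blast
qed

lemma laplace_nonneg: "laplace \<sigma> x \<ge> 0"
  by (simp add: laplace_def)

lemma laplace_antimono:
  assumes "CM_measure \<sigma>" "0 < x" "x \<le> y"
  shows "laplace \<sigma> y \<le> laplace \<sigma> x"
  unfolding laplace_def using assms
  by (intro integral_mono_AE) (auto simp: CM_measure_integrable CM_measure_space intro!: mult_right_mono)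

lemma laplace_measurable:
  assumes "CM_measure \<sigma>"
  shows "laplace \<sigma> \<in> borel_measurable borel"
proof -
  interpret sigma_finite_measure \<sigma> by (rule CM_measure_sigma_finite[OF assms])
  have [measurable]: "(\<lambda>t. t) \<in> borel_measurable \<sigma>" by (rule CM_measure_measurable[OF assms]) simp
  show ?thesis unfolding laplace_def[abs_def] by measurable
qed

lemma laplace_zero_imp_null:
  assumes "CM_measure \<sigma>" "a > 0" "laplace \<sigma> a = 0"
  shows "emeasure \<sigma> A = 0"
proof -
  have "AE t in \<sigma>. exp (- (a * t)) = 0"
    using assms integral_nonneg_eq_0_iff_AE[OF CM_measure_integrable[OF assms(1,2)]]
    by (simp add: laplace_def)
  then have "AE t in \<sigma>. False" by simp
  then have "emeasure \<sigma> (space \<sigma>) = 0"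
    using emeasure_eq_0_AE[of "\<lambda>_. True" \<sigma>] by simp
  then show ?thesis
    by (metis emeasure_space le_zero_eq)
qed

lemma CM_measure_eq_null:
  assumes "CM_measure \<sigma>" "CM_measure \<tau>" "a > 0" "laplace \<sigma> a = 0" "laplace \<tau> a = 0"
  shows "\<sigma> = \<tau>"
  using assms by (intro measure_eqI) (simp_all add: laplace_zero_imp_null CM_measure_sets)

text \<open>
  A point \<open>z\<close> of the right half-plane lies in the ball of radius \<open>a\<close> about a large real number \<open>a\<close>,
  and there \<open>exp (- (a * t))\<close> serves as the weight in \<open>holomorphic_exp_integral\<close>.
\<close>
lemma laplace_complex_holomorphic:
  assumes "CM_measure \<sigma>"
  shows "(\<lambda>z. \<integral>t. exp (- (z * complex_of_real t)) \<partial>\<sigma>) holomorphic_on {z. Re z > 0}"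
proof (rule holomorphic_onI)
  fix z :: complex assume "z \<in> {z. Re z > 0}"
  then have z: "Re z > 0" by simp
  \<comment> \<open>any \<open>a\<close> with \<open>\<bar>z\<bar>\<^sup>2 < 2 a Re z\<close> is large enough\<close>
  define a where "a = ((Re z)\<^sup>2 + (Im z)\<^sup>2) / Re z"
  have a: "a > 0" using z by (auto simp: a_def intro!: divide_pos_pos add_pos_nonneg)
  have "(norm (of_real a - z))\<^sup>2 = a\<^sup>2 - (2 * (a * Re z) - ((Re z)\<^sup>2 + (Im z)\<^sup>2))"
    unfolding cmod_power2 by (simp add: power2_eq_square algebra_simps)
  also have "a * Re z = (Re z)\<^sup>2 + (Im z)\<^sup>2" using z by (simp add: a_def)
  also have "a\<^sup>2 - (2 * ((Re z)\<^sup>2 + (Im z)\<^sup>2) - ((Re z)\<^sup>2 + (Im z)\<^sup>2)) < a\<^sup>2"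
  proof -
    have "a\<^sup>2 - (2 * N - N) < a\<^sup>2" if "N > 0" for N :: real using that by simp
    moreover have "(Re z)\<^sup>2 + (Im z)\<^sup>2 > 0" using z by (intro add_pos_nonneg) auto
    ultimately show ?thesis .
  qed
  finally have in_ball: "z \<in> ball (of_real a) a"
    using a power2_less_imp_less[of "norm (of_real a - z)" a] by (simp add: dist_norm)
  have meas: "(\<lambda>t. t) \<in> borel_measurable \<sigma>" "(\<lambda>t. exp (- (a * t))) \<in> borel_measurable \<sigma>"
    by (auto intro!: CM_measure_measurable[OF assms])
  have int: "integrable \<sigma> (\<lambda>t. exp (r * \<bar>t\<bar>) * \<bar>exp (- (a * t))\<bar>)" if "0 \<le> r" "r < a" for r
  proof (rule Bochner_Integration.integrable_cong[THEN iffD1, OF refl _ CM_measure_integrable[OF assms, of "a - r"]])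
    show "exp (- ((a - r) * t)) = exp (r * \<bar>t\<bar>) * \<bar>exp (- (a * t))\<bar>" if "t \<in> space \<sigma>" for t
      using that by (simp add: CM_measure_space[OF assms] algebra_simps flip: exp_add)
  qed (use that in simp)
  have "(\<lambda>z. \<integral>t. exp (- ((z - of_real a) * of_real t)) * of_real (exp (- (a * t))) \<partial>\<sigma>)
      holomorphic_on ball (of_real a) a"
    by (rule holomorphic_exp_integral[OF meas int])
  moreover have "exp (- ((z - of_real a) * of_real t)) * of_real (exp (- (a * t)))
      = exp (- (z * complex_of_real t))" for z t
    unfolding exp_of_real[symmetric] exp_add[symmetric] by (simp add: algebra_simps)
  ultimately have "(\<lambda>z. \<integral>t. exp (- (z * complex_of_real t)) \<partial>\<sigma>) holomorphic_on ball (of_real a) a"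
    by simp
  then show "(\<lambda>z. \<integral>t. exp (- (z * complex_of_real t)) \<partial>\<sigma>) field_differentiable at z within {z. 0 < Re z}"
    using in_ball by (meson field_differentiable_at_within holomorphic_on_imp_differentiable_at open_ball)
qed

lemma laplace_complex_of_real:
  "(\<integral>t. exp (- (complex_of_real x * complex_of_real t)) \<partial>\<sigma>) = complex_of_real (laplace \<sigma> x)"
proof -
  have "exp (- (complex_of_real x * complex_of_real t)) = complex_of_real (exp (- (x * t)))" for t
    by (simp flip: exp_of_real)
  then show ?thesis by (simp add: laplace_def del: of_real_exp)
qed

lemma laplace_complex_eqI:
  assumes "CM_measure \<sigma>" "CM_measure \<tau>" and eq: "\<And>x. x \<in> {0<..<1} \<Longrightarrow> laplace \<sigma> x = laplace \<tau> x"
    and z: "Re z > 0"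
  shows "(\<integral>t. exp (- (z * complex_of_real t)) \<partial>\<sigma>) = (\<integral>t. exp (- (z * complex_of_real t)) \<partial>\<tau>)"
proof -
  let ?h = "\<lambda>z. (\<integral>t. exp (- (z * complex_of_real t)) \<partial>\<sigma>) - (\<integral>t. exp (- (z * complex_of_real t)) \<partial>\<tau>)"
  have "?h z = 0"
  proof (rule analytic_continuation[of ?h "{z. Re z > 0}" "complex_of_real ` {0<..<1}" "of_real (1/2)"])
    show "?h holomorphic_on {z. 0 < Re z}"
      by (intro holomorphic_intros laplace_complex_holomorphic assms)
    show "complex_of_real (1/2) islimpt complex_of_real ` {0<..<1}"
    proof (rule islimpt_isCont_image)
      show "(1/2::real) islimpt {0<..<1}"
        by (intro interior_limit_point) (auto simp: interior_open)
      show "\<forall>\<^sub>F y in at (1 / 2). complex_of_real y \<noteq> complex_of_real (1 / 2)"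
        unfolding of_real_eq_iff by (simp add: eventually_at_filter)
    qed auto
    show "connected {z. 0 < Re z}" by (intro convex_connected convex_halfspace_Re_gt)
    show "?h v = 0" if "v \<in> complex_of_real ` {0<..<1}" for v
      using that eq by (auto simp: laplace_complex_of_real)
  qed (use z in \<open>auto simp: open_halfspace_Re_gt\<close>)
  then show ?thesis by simp
qed

lemma laplace_eqI:
  assumes "CM_measure \<sigma>" "CM_measure \<tau>" "\<And>x. x \<in> {0<..<1} \<Longrightarrow> laplace \<sigma> x = laplace \<tau> x" "x > 0"
  shows "laplace \<sigma> x = laplace \<tau> x"
  using laplace_complex_eqI[OF assms(1-3), of "of_real x"] assms(4)
  by (simp add: laplace_complex_of_real)

text \<open>
  The probability distribution on the whole line with density \<open>exp (- (a * t))\<close> relative to \<open>\<sigma>\<close>, up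
  to normalization: the exponential tilting of \<open>\<sigma>\<close>. It makes results on distributions of real random
  variables applicable to the possibly infinite measure \<open>\<sigma>\<close>.
\<close>
definition tilted :: "real \<Rightarrow> real measure \<Rightarrow> real measure" where
  "tilted a \<sigma> = distr (density \<sigma> (\<lambda>t. ennreal (exp (- (a * t)) / laplace \<sigma> a))) borel (\<lambda>t. t)"

lemma
  fixes h :: "real \<Rightarrow> 'b :: {banach, second_countable_topology}"
  assumes \<sigma>: "CM_measure \<sigma>" and h: "h \<in> borel_measurable borel"
  shows integrable_tilted:
      "integrable (tilted a \<sigma>) h \<longleftrightarrow> integrable \<sigma> (\<lambda>t. (exp (- (a * t)) / laplace \<sigma> a) *\<^sub>R h t)"
    and integral_tilted:
      "integral\<^sup>L (tilted a \<sigma>) h = (\<integral>t. (exp (- (a * t)) / laplace \<sigma> a) *\<^sub>R h t \<partial>\<sigma>)"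
proof -
  have [measurable]: "(\<lambda>t. t) \<in> borel_measurable \<sigma>" "h \<in> borel_measurable \<sigma>"
    by (auto intro!: CM_measure_measurable[OF \<sigma>] h)
  note [measurable] = h
  show "integrable (tilted a \<sigma>) h \<longleftrightarrow> integrable \<sigma> (\<lambda>t. (exp (- (a * t)) / laplace \<sigma> a) *\<^sub>R h t)"
    by (simp add: tilted_def integrable_distr_eq integrable_density laplace_nonneg)
  show "integral\<^sup>L (tilted a \<sigma>) h = (\<integral>t. (exp (- (a * t)) / laplace \<sigma> a) *\<^sub>R h t \<partial>\<sigma>)"
    by (simp add: tilted_def integral_distr integral_density laplace_nonneg)
qed

lemma nn_integral_tilted:
  assumes \<sigma>: "CM_measure \<sigma>" and h: "h \<in> borel_measurable borel"
  shows "(\<integral>\<^sup>+t. h t \<partial>tilted a \<sigma>) = (\<integral>\<^sup>+t. ennreal (exp (- (a * t)) / laplace \<sigma> a) * h t \<partial>\<sigma>)"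
proof -
  have [measurable]: "(\<lambda>t. t) \<in> borel_measurable \<sigma>" "h \<in> borel_measurable \<sigma>"
    by (auto intro!: CM_measure_measurable[OF \<sigma>] h)
  note [measurable] = h
  show ?thesis by (simp add: tilted_def nn_integral_distr nn_integral_density)
qed

lemma real_distribution_tilted:
  assumes \<sigma>: "CM_measure \<sigma>" and a: "a > 0" "laplace \<sigma> a > 0"
  shows "real_distribution (tilted a \<sigma>)"
proof -
  have "emeasure (tilted a \<sigma>) (space (tilted a \<sigma>)) = (\<integral>\<^sup>+t. 1 \<partial>tilted a \<sigma>)" by simp
  also have "\<dots> = (\<integral>\<^sup>+t. ennreal (exp (- (a * t)) / laplace \<sigma> a) \<partial>\<sigma>)"
    by (subst nn_integral_tilted[OF \<sigma>]) auto
  also have "\<dots> = ennreal (\<integral>t. exp (- (a * t)) / laplace \<sigma> a \<partial>\<sigma>)"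
    using CM_measure_integrable[OF \<sigma> a(1)] a(2) by (intro nn_integral_eq_integral) auto
  also have "(\<integral>t. exp (- (a * t)) / laplace \<sigma> a \<partial>\<sigma>) = laplace \<sigma> a / laplace \<sigma> a"
    by (simp add: laplace_def)
  finally have "prob_space (tilted a \<sigma>)" using a(2) by (intro prob_spaceI) simp
  then show ?thesis
    by (simp add: real_distribution_def real_distribution_axioms_def tilted_def)
qed

text \<open>
  By analytic continuation the complex transforms agree on the line \<open>Re z = 1\<close>, where they are, up to
  a constant, the characteristic functions of the measures tilted by \<open>exp (- t)\<close>. Levy's theorem
  identifies the tilted measures, and tilting can be undone.
\<close>
lemma laplace_unique:
  assumes \<sigma>: "CM_measure \<sigma>" and \<tau>: "CM_measure \<tau>"
    and eq: "\<And>x. x \<in> {0<..<1} \<Longrightarrow> laplace \<sigma> x = laplace \<tau> x"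
  shows "\<sigma> = \<tau>"
proof (cases "laplace \<sigma> 1 = 0")
  case True
  then show ?thesis
    using CM_measure_eq_null[OF \<sigma> \<tau>, of 1] laplace_eqI[OF \<sigma> \<tau> eq, of 1] by simp
next
  case False
  define m where "m = laplace \<sigma> 1"
  have m: "m > 0" using False laplace_nonneg[of \<sigma> 1] by (simp add: m_def)
  have m': "laplace \<tau> 1 = m" using laplace_eqI[OF \<sigma> \<tau> eq, of 1] by (simp add: m_def)
  have char: "char (tilted 1 \<rho>) s = (\<integral>t. exp (- ((1 - \<i> * of_real s) * complex_of_real t)) \<partial>\<rho>) / of_real m"
    if "CM_measure \<rho>" "laplace \<rho> 1 = m" for \<rho> s
  proof -
    have "char (tilted 1 \<rho>) s = (\<integral>t. (exp (- (1 * t)) / m) *\<^sub>R iexp (s * t) \<partial>\<rho>)"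
      unfolding char_def by (subst integral_tilted[OF that(1)]) (auto simp: that)
    also have "\<dots> = (\<integral>t. exp (- ((1 - \<i> * of_real s) * complex_of_real t)) / of_real m \<partial>\<rho>)"
    proof (intro Bochner_Integration.integral_cong refl)
      fix t
      have "exp (- ((1 - \<i> * of_real s) * complex_of_real t)) = exp (of_real (- t)) * iexp (s * t)"
        by (simp add: algebra_simps flip: exp_add)
      then show "(exp (- (1 * t)) / m) *\<^sub>R iexp (s * t) =
          exp (- ((1 - \<i> * of_real s) * complex_of_real t)) / of_real m"
        by (simp add: scaleR_conv_of_real flip: exp_of_real)
    qed
    finally show ?thesis by simp
  qed
  have "tilted 1 \<sigma> = tilted 1 \<tau>"
  proof (rule Levy_uniqueness)
    show "real_distribution (tilted 1 \<sigma>)" "real_distribution (tilted 1 \<tau>)"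
      using m m' by (auto intro!: real_distribution_tilted \<sigma> \<tau> simp: m_def)
    show "char (tilted 1 \<sigma>) = char (tilted 1 \<tau>)"
      using laplace_complex_eqI[OF \<sigma> \<tau> eq]
      by (intro ext) (simp add: char[OF \<sigma>] char[OF \<tau>] m' m_def[symmetric])
  qed
  moreover have recover: "emeasure \<rho> A = (\<integral>\<^sup>+t. ennreal (m * exp t) * indicator A t \<partial>tilted 1 \<rho>)"
    if \<rho>: "CM_measure \<rho>" "laplace \<rho> 1 = m" and A: "A \<in> sets (restrict_space borel {0..})" for \<rho> A
  proof -
    have [measurable]: "A \<in> sets borel"
      using A by (simp add: sets_restrict_space_iff)
    have A': "A \<in> sets \<rho>" using A CM_measure_sets[OF \<rho>(1)] by simp
    have "(\<integral>\<^sup>+t. ennreal (m * exp t) * indicator A t \<partial>tilted 1 \<rho>)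
        = (\<integral>\<^sup>+t. ennreal (exp (- (1 * t)) / m) * (ennreal (m * exp t) * indicator A t) \<partial>\<rho>)"
      by (subst nn_integral_tilted[OF \<rho>(1)]) (auto simp: \<rho>(2))
    also have "\<dots> = (\<integral>\<^sup>+t. indicator A t \<partial>\<rho>)"
    proof (intro nn_integral_cong)
      fix t
      have "exp (- (1 * t)) / m * (m * exp t) = 1"
        using m by (simp add: exp_minus)
      then have "ennreal (exp (- (1 * t)) / m) * ennreal (m * exp t) = 1"
        using m by (subst ennreal_mult[symmetric]) auto
      then show "ennreal (exp (- (1 * t)) / m) * (ennreal (m * exp t) * indicator A t) = indicator A t"
        by (simp only: mult.assoc[symmetric] mult_1)
    qed
    finally show ?thesis using A' by simp
  qed
  ultimately show ?thesis
    using recover[OF \<sigma>] recover[OF \<tau> m']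
    by (intro measure_eqI) (auto simp: CM_measure_sets[OF \<sigma>] CM_measure_sets[OF \<tau>] m_def)
qed

section \<open>Combinations of measures and point masses\<close>

definition mix :: "real \<Rightarrow> real measure \<Rightarrow> real \<Rightarrow> real measure \<Rightarrow> real measure" where
  "mix a \<sigma> b \<tau> = measure_of {0..} (sets (restrict_space borel {0..}))
     (\<lambda>A. ennreal a * emeasure \<sigma> A + ennreal b * emeasure \<tau> A)"

lemma sets_mix: "sets (mix a \<sigma> b \<tau>) = sets (restrict_space borel {0..})"
  unfolding mix_def using sets.sigma_sets_eq[of "restrict_space borel {0::real..}"]
    sets.space_closed[of "restrict_space borel {0::real..}"]
  by (simp add: space_restrict_space)

lemma emeasure_mix:
  assumes "sets \<sigma> = sets (restrict_space borel {0..})" "sets \<tau> = sets (restrict_space borel {0..})"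
    and A: "A \<in> sets (restrict_space borel {0..})"
  shows "emeasure (mix a \<sigma> b \<tau>) A = ennreal a * emeasure \<sigma> A + ennreal b * emeasure \<tau> A"
proof (rule emeasure_measure_of[OF mix_def])
  show "sets (restrict_space borel {0..}) \<subseteq> Pow {0::real..}"
    using sets.space_closed[of "restrict_space borel {0::real..}"] by (simp add: space_restrict_space)
  show "A \<in> sets (mix a \<sigma> b \<tau>)" using A by (simp add: sets_mix)
  show "positive (sets (mix a \<sigma> b \<tau>)) (\<lambda>A. ennreal a * emeasure \<sigma> A + ennreal b * emeasure \<tau> A)"
    by (simp add: positive_def)
  show "countably_additive (sets (mix a \<sigma> b \<tau>)) (\<lambda>A. ennreal a * emeasure \<sigma> A + ennreal b * emeasure \<tau> A)"
    unfolding sets_mix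
  proof (rule countably_additiveI)
    fix B :: "nat \<Rightarrow> real set"
    assume B: "range B \<subseteq> sets (restrict_space borel {0..})" "disjoint_family B"
    have "(\<Sum>i. ennreal a * emeasure \<sigma> (B i) + ennreal b * emeasure \<tau> (B i))
        = (\<Sum>i. ennreal a * emeasure \<sigma> (B i)) + (\<Sum>i. ennreal b * emeasure \<tau> (B i))"
      by (intro suminf_add[symmetric] summableI)
    also have "\<dots> = ennreal a * emeasure \<sigma> (\<Union>i. B i) + ennreal b * emeasure \<tau> (\<Union>i. B i)"
      using B assms by (simp add: suminf_emeasure)
    finally show "(\<Sum>i. ennreal a * emeasure \<sigma> (B i) + ennreal b * emeasure \<tau> (B i))
        = ennreal a * emeasure \<sigma> (\<Union> (range B)) + ennreal b * emeasure \<tau> (\<Union> (range B))" .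
  qed
qed

lemma nn_integral_mix:
  assumes \<sigma>: "sets \<sigma> = sets (restrict_space borel {0..})" and \<tau>: "sets \<tau> = sets (restrict_space borel {0..})"
    and f: "f \<in> borel_measurable (restrict_space borel {0..})"
  shows "(\<integral>\<^sup>+t. f t \<partial>mix a \<sigma> b \<tau>) = ennreal a * (\<integral>\<^sup>+t. f t \<partial>\<sigma>) + ennreal b * (\<integral>\<^sup>+t. f t \<partial>\<tau>)"
proof -
  have sp: "space (mix a \<sigma> b \<tau>) = {0..}" "space \<sigma> = {0..}" "space \<tau> = {0..}"
    using \<sigma>[THEN sets_eq_imp_space_eq] \<tau>[THEN sets_eq_imp_space_eq]
      sets_mix[of a \<sigma> b \<tau>, THEN sets_eq_imp_space_eq] by (simp_all add: space_restrict_space)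
  have tr: "g \<in> borel_measurable (mix a \<sigma> b \<tau>)" "g \<in> borel_measurable \<sigma>" "g \<in> borel_measurable \<tau>"
    if "g \<in> borel_measurable (restrict_space borel {0..})" for g :: "real \<Rightarrow> ennreal"
    using that by (simp_all only: measurable_cong_sets[OF \<sigma> refl] measurable_cong_sets[OF \<tau> refl]
      measurable_cong_sets[OF sets_mix refl])
  show ?thesis using f
  proof induct
    case (cong f g)
    have "integral\<^sup>N M f = integral\<^sup>N M g" if "space M = {0..}" for M
      using cong(3) that by (intro nn_integral_cong) (auto simp: space_restrict_space)
    then show ?case using cong(4) sp by simp
  next
    case (set A)
    then show ?case using \<sigma> \<tau> by (simp add: sets_mix emeasure_mix)
  next
    case (mult u c)
    then show ?case by (simp add: nn_integral_cmult tr distrib_left mult_ac)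
  next
    case (add u v)
    then show ?case by (simp add: nn_integral_add tr distrib_left add_ac)
  next
    case (seq U)
    have 1: "(\<integral>\<^sup>+t. (SUP i. U i) t \<partial>M) = (SUP i. \<integral>\<^sup>+t. U i t \<partial>M)"
      if "\<And>i. U i \<in> borel_measurable M" for M
      using nn_integral_monotone_convergence_SUP[OF \<open>incseq U\<close> that] by (simp add: image_comp)
    have inc: "incseq (\<lambda>i. ennreal c * integral\<^sup>N M (U i))" for c M
      using \<open>incseq U\<close> by (auto simp: incseq_def le_fun_def intro!: mult_left_mono nn_integral_mono)
    have "(\<integral>\<^sup>+t. (SUP i. U i) t \<partial>mix a \<sigma> b \<tau>)
        = (SUP i. ennreal a * integral\<^sup>N \<sigma> (U i) + ennreal b * integral\<^sup>N \<tau> (U i))"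
      unfolding 1[OF tr(1)[OF seq(1)]] by (intro SUP_cong refl seq)
    also have "\<dots> = ennreal a * (SUP i. integral\<^sup>N \<sigma> (U i)) + ennreal b * (SUP i. integral\<^sup>N \<tau> (U i))"
      unfolding ennreal_SUP_add[OF inc inc] SUP_mult_left_ennreal ..
    finally show ?case
      unfolding 1[OF tr(2)[OF seq(1)]] 1[OF tr(3)[OF seq(1)]] .
  qed
qed

lemma
  assumes \<sigma>: "CM_measure \<sigma>" and \<tau>: "CM_measure \<tau>" and ab: "a \<ge> 0" "b \<ge> 0"
  shows CM_measure_mix: "CM_measure (mix a \<sigma> b \<tau>)"
    and laplace_mix: "x > 0 \<Longrightarrow> laplace (mix a \<sigma> b \<tau>) x = a * laplace \<sigma> x + b * laplace \<tau> x"
proof -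
  note S = CM_measure_sets[OF \<sigma>] CM_measure_sets[OF \<tau>]
  have int: "integrable (mix a \<sigma> b \<tau>) (\<lambda>t. exp (- (x * t))) \<and>
      laplace (mix a \<sigma> b \<tau>) x = a * laplace \<sigma> x + b * laplace \<tau> x" if x: "x > 0" for x
  proof -
    have "(\<integral>\<^sup>+t. ennreal (exp (- (x * t))) \<partial>mix a \<sigma> b \<tau>)
        = ennreal a * (\<integral>\<^sup>+t. ennreal (exp (- (x * t))) \<partial>\<sigma>) + ennreal b * (\<integral>\<^sup>+t. ennreal (exp (- (x * t))) \<partial>\<tau>)"
      by (intro nn_integral_mix S measurable_restrict_space1) simp
    also have "(\<integral>\<^sup>+t. ennreal (exp (- (x * t))) \<partial>\<sigma>) = ennreal (laplace \<sigma> x)"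
      using CM_measure_integrable[OF \<sigma> x] by (simp add: nn_integral_eq_integral laplace_def)
    also have "(\<integral>\<^sup>+t. ennreal (exp (- (x * t))) \<partial>\<tau>) = ennreal (laplace \<tau> x)"
      using CM_measure_integrable[OF \<tau> x] by (simp add: nn_integral_eq_integral laplace_def)
    also have "ennreal a * ennreal (laplace \<sigma> x) + ennreal b * ennreal (laplace \<tau> x)
        = ennreal (a * laplace \<sigma> x + b * laplace \<tau> x)"
      using ab laplace_nonneg by (simp add: ennreal_mult ennreal_plus)
    finally show ?thesis using ab laplace_nonneg
      unfolding laplace_def[of "mix a \<sigma> b \<tau>"]
      by (subst (asm) nn_integral_eq_integrable)
        (auto intro!: measurable_restrict_space1 simp: measurable_cong_sets[OF sets_mix refl])
  qed
  then show "CM_measure (mix a \<sigma> b \<tau>)" by (simp add: CM_measure_def sets_mix)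
  show "x > 0 \<Longrightarrow> laplace (mix a \<sigma> b \<tau>) x = a * laplace \<sigma> x + b * laplace \<tau> x"
    using int by blast
qed

definition point_mass :: "real \<Rightarrow> real measure" where
  "point_mass t = return (restrict_space borel {0..}) t"

lemma
  assumes t: "t \<ge> 0"
  shows CM_measure_point_mass: "CM_measure (point_mass t)"
    and laplace_point_mass: "laplace (point_mass t) x = exp (- (x * t))"
proof -
  have m: "(\<lambda>t. exp (- (x * t))) \<in> borel_measurable (restrict_space borel {0..})" for x :: real
    by (intro measurable_restrict_space1) simp
  have t': "t \<in> space (restrict_space borel {0..})" using t by (simp add: space_restrict_space)
  have "integrable (point_mass t) (\<lambda>t. exp (- (x * t)))" for x
    unfolding point_mass_def
  proof (rule integrableI_nonneg)
    show "(\<integral>\<^sup>+ s. ennreal (exp (- (x * s))) \<partial>return (restrict_space borel {0..}) t) < \<infinity>"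
      using m[of x] by (subst nn_integral_return[OF t']) auto
  qed (use m in auto)
  then show "CM_measure (point_mass t)" by (simp add: CM_measure_def point_mass_def)
  show "laplace (point_mass t) x = exp (- (x * t))"
    unfolding laplace_def point_mass_def by (rule integral_return[OF t' m])
qed

section \<open>The inner product of square-integrable functions on the unit interval\<close>

abbreviation unit_interval :: "real measure" where
  "unit_interval \<equiv> restrict_space lborel {0<..<1}"

definition sq_integrable :: "(real \<Rightarrow> real) \<Rightarrow> bool" where
  "sq_integrable f \<longleftrightarrow> f \<in> borel_measurable unit_interval \<and> integrable unit_interval (\<lambda>x. (f x)\<^sup>2)"

definition inner2 :: "(real \<Rightarrow> real) \<Rightarrow> (real \<Rightarrow> real) \<Rightarrow> real" where
  "inner2 f g = (\<integral>x. f x * g x \<partial>unit_interval)"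

lemma finite_measure_unit_interval: "finite_measure unit_interval"
  by (rule finite_measureI) (simp add: space_restrict_space emeasure_restrict_space)

lemma set_integrable_unit_interval: "set_integrable lborel {0<..<1} f \<longleftrightarrow> integrable unit_interval f"
  for f :: "real \<Rightarrow> real"
  by (simp add: set_integrable_def integrable_restrict_space)

lemma set_integral_unit_interval: "(LBINT x:{0<..<1}. f x) = (\<integral>x. f x \<partial>unit_interval)"
  for f :: "real \<Rightarrow> real"
  by (simp add: set_lebesgue_integral_def integral_restrict_space)

lemma measurable_unit_interval:
  "f \<in> borel_measurable borel \<Longrightarrow> f \<in> borel_measurable unit_interval"
  by (rule measurable_restrict_space1) simp

lemma sq_integrable_measurable: "sq_integrable f \<Longrightarrow> f \<in> borel_measurable unit_interval"
  by (simp add: sq_integrable_def)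

lemma sq_integrable_mult:
  assumes "sq_integrable f" "sq_integrable g"
  shows "integrable unit_interval (\<lambda>x. f x * g x)"
proof (rule Bochner_Integration.integrable_bound)
  show "integrable unit_interval (\<lambda>x. (f x)\<^sup>2 + (g x)\<^sup>2)"
    using assms by (auto simp: sq_integrable_def)
  show "(\<lambda>x. f x * g x) \<in> borel_measurable unit_interval"
    using assms by (auto simp: sq_integrable_def)
  have "\<bar>a * b\<bar> \<le> a\<^sup>2 + b\<^sup>2" for a b :: real
  proof -
    have "2 * (\<bar>a\<bar> * \<bar>b\<bar>) \<le> a\<^sup>2 + b\<^sup>2"
      using sum_squares_bound[of "\<bar>a\<bar>" "\<bar>b\<bar>"] by (simp add: mult.assoc)
    moreover have "\<bar>a\<bar> * \<bar>b\<bar> \<ge> 0" by simp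
    ultimately show ?thesis unfolding abs_mult by linarith
  qed
  then show "AE x in unit_interval. norm (f x * g x) \<le> norm ((f x)\<^sup>2 + (g x)\<^sup>2)"
    by (intro AE_I2) simp
qed

lemma sq_integrable_bounded:
  assumes "f \<in> borel_measurable borel" "\<And>x. x \<in> {0<..<1} \<Longrightarrow> \<bar>f x\<bar> \<le> B"
  shows "sq_integrable f"
proof -
  interpret finite_measure unit_interval by (rule finite_measure_unit_interval)
  have m: "f \<in> borel_measurable unit_interval" using assms(1) by (rule measurable_unit_interval)
  moreover have "integrable unit_interval (\<lambda>x. (f x)\<^sup>2)"
  proof (rule integrable_const_bound[where B = "B\<^sup>2"])
    have "\<bar>f x\<bar>\<^sup>2 \<le> B\<^sup>2" if "x \<in> {0<..<1}" for x
      using assms(2)[OF that] by (intro power_mono) auto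
    then show "AE x in unit_interval. norm ((f x)\<^sup>2) \<le> B\<^sup>2"
      by (intro AE_I2) (simp add: space_restrict_space)
  qed (use m in measurable)
  ultimately show ?thesis by (simp add: sq_integrable_def)
qed

lemma sq_integrable_scale_add:
  assumes "sq_integrable f" "sq_integrable g"
  shows "sq_integrable (\<lambda>x. a * f x + b * g x)"
proof -
  have "integrable unit_interval (\<lambda>x. a\<^sup>2 * (f x)\<^sup>2 + (2 * a * b) * (f x * g x) + b\<^sup>2 * (g x)\<^sup>2)"
    using assms sq_integrable_mult[OF assms] by (auto simp: sq_integrable_def)
  moreover have "(a * f x + b * g x)\<^sup>2 = a\<^sup>2 * (f x)\<^sup>2 + (2 * a * b) * (f x * g x) + b\<^sup>2 * (g x)\<^sup>2" for x
    by (simp add: power2_eq_square algebra_simps)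
  moreover have "(\<lambda>x. a * f x + b * g x) \<in> borel_measurable unit_interval"
    using assms[THEN sq_integrable_measurable] by measurable
  ultimately show ?thesis by (simp add: sq_integrable_def)
qed

lemma sq_integrable_diff:
  "sq_integrable f \<Longrightarrow> sq_integrable g \<Longrightarrow> sq_integrable (\<lambda>x. f x - g x)"
  using sq_integrable_scale_add[of f g 1 "-1"] by simp

lemma sq_integrable_integrable: "sq_integrable f \<Longrightarrow> integrable unit_interval f"
  using sq_integrable_mult[of f "\<lambda>_. 1"] sq_integrable_bounded[of "\<lambda>_. 1" 1] by simp

lemma inner2_commute: "inner2 f g = inner2 g f"
  by (simp add: inner2_def mult.commute)

lemma inner2_scale_add:
  assumes "sq_integrable f" "sq_integrable g" "sq_integrable h"
  shows "inner2 (\<lambda>x. a * f x + b * g x) h = a * inner2 f h + b * inner2 g h"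
proof -
  have "inner2 (\<lambda>x. a * f x + b * g x) h = (\<integral>x. a * (f x * h x) + b * (g x * h x) \<partial>unit_interval)"
    by (simp add: inner2_def algebra_simps)
  then show ?thesis using sq_integrable_mult[OF assms(1,3)] sq_integrable_mult[OF assms(2,3)]
    by (simp add: inner2_def)
qed

lemma inner2_diff:
  "sq_integrable f \<Longrightarrow> sq_integrable g \<Longrightarrow> sq_integrable h \<Longrightarrow>
    inner2 (\<lambda>x. f x - g x) h = inner2 f h - inner2 g h"
  using inner2_scale_add[of f g h 1 "-1"] by simp

lemma inner2_cong:
  "(\<And>x. x \<in> {0<..<1} \<Longrightarrow> f x = f' x) \<Longrightarrow> (\<And>x. x \<in> {0<..<1} \<Longrightarrow> g x = g' x) \<Longrightarrow> inner2 f g = inner2 f' g'"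
  unfolding inner2_def by (intro Bochner_Integration.integral_cong) (auto simp: space_restrict_space)

lemma sq_integrable_cong:
  assumes "\<And>x. x \<in> {0<..<1} \<Longrightarrow> f x = g x"
  shows "sq_integrable f \<longleftrightarrow> sq_integrable g"
proof -
  have "f \<in> borel_measurable unit_interval \<longleftrightarrow> g \<in> borel_measurable unit_interval"
    using assms by (intro measurable_cong) (simp add: space_restrict_space)
  moreover have "integrable unit_interval (\<lambda>x. (f x)\<^sup>2) \<longleftrightarrow> integrable unit_interval (\<lambda>x. (g x)\<^sup>2)"
    using assms by (intro Bochner_Integration.integrable_cong) (auto simp: space_restrict_space)
  ultimately show ?thesis by (simp add: sq_integrable_def)
qed

lemma inner2_self_nonneg: "inner2 f f \<ge> 0"
  by (simp add: inner2_def)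

lemma inner2_diff_self:
  assumes "sq_integrable f" "sq_integrable g"
  shows "inner2 (\<lambda>x. f x - g x) (\<lambda>x. f x - g x) = inner2 f f - 2 * inner2 f g + inner2 g g"
proof -
  note d = inner2_diff[OF assms]
  have "inner2 (\<lambda>x. f x - g x) f = inner2 f f - inner2 f g" "inner2 (\<lambda>x. f x - g x) g = inner2 f g - inner2 g g"
    using d assms by (simp_all add: inner2_commute[of g f])
  then show ?thesis
    using d[OF sq_integrable_diff[OF assms]]
    by (simp add: inner2_commute[of f "\<lambda>x. f x - g x"] inner2_commute[of g "\<lambda>x. f x - g x"])
qed

definition unit_laplace :: "(real \<Rightarrow> real) \<Rightarrow> real \<Rightarrow> real" where
  "unit_laplace g t = (\<integral>x. exp (- (x * t)) * g x \<partial>unit_interval)"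

text \<open>
  Fubini's theorem turns integration of a finite Laplace transform against \<open>\<sigma>\<close> into an inner product
  in \<open>L\<^sup>2(0,1)\<close>. All integrations of the Caprini function against measures rest on this.
\<close>
lemma
  assumes \<sigma>: "CM_measure \<sigma>" and sq: "sq_integrable (laplace \<sigma>)" and g: "sq_integrable g"
  shows integrable_unit_laplace: "integrable \<sigma> (unit_laplace g)"
    and integral_unit_laplace: "(\<integral>t. unit_laplace g t \<partial>\<sigma>) = inner2 (laplace \<sigma>) g"
proof -
  interpret U: finite_measure unit_interval by (rule finite_measure_unit_interval)
  interpret sigma_finite_measure \<sigma> by (rule CM_measure_sigma_finite[OF \<sigma>])
  interpret P: pair_sigma_finite unit_interval \<sigma> ..
  have [measurable]: "(\<lambda>t. t) \<in> borel_measurable \<sigma>" "(\<lambda>t. t) \<in> borel_measurable unit_interval"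
    "g \<in> borel_measurable unit_interval"
    using g by (auto intro: CM_measure_measurable[OF \<sigma>] measurable_unit_interval sq_integrable_measurable)
  have eq: "(\<integral>t. norm (exp (- (x * t)) * g x) \<partial>\<sigma>) = laplace \<sigma> x * \<bar>g x\<bar>" for x
    by (simp add: abs_mult laplace_def)
  have g': "sq_integrable (\<lambda>x. \<bar>g x\<bar>)" using g by (simp add: sq_integrable_def)
  have int: "integrable (unit_interval \<Otimes>\<^sub>M \<sigma>) (\<lambda>(x, t). exp (- (x * t)) * g x)"
  proof (rule P.Fubini_integrable)
    show "(\<lambda>(x, t). exp (- (x * t)) * g x) \<in> borel_measurable (unit_interval \<Otimes>\<^sub>M \<sigma>)"
      by measurable
    show "integrable unit_interval (\<lambda>x. \<integral>t. norm (case (x, t) of (x, t) \<Rightarrow> exp (- (x * t)) * g x) \<partial>\<sigma>)"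
      using sq_integrable_mult[OF sq g'] by (simp only: eq prod.case)
    show "AE x in unit_interval. integrable \<sigma> (\<lambda>t. case (x, t) of (x, t) \<Rightarrow> exp (- (x * t)) * g x)"
      by (rule AE_I2) (simp add: CM_measure_integrable[OF \<sigma>] space_restrict_space)
  qed
  show "integrable \<sigma> (unit_laplace g)"
    using P.integrable_snd[OF int] by (simp add: unit_laplace_def[abs_def])
  show "(\<integral>t. unit_laplace g t \<partial>\<sigma>) = inner2 (laplace \<sigma>) g"
    using P.Fubini_integral[OF int] by (simp add: unit_laplace_def[abs_def] inner2_def laplace_def)
qed

section \<open>Compactness and existence of a minimizer\<close>

text \<open>
  Weak convergence only controls bounded continuous test functions. A bound on the exponential moment
  of order \<open>b > a\<close> makes the error of truncating the function at \<open>t = k\<close> small uniformly in \<open>n\<close>, so that the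
  limits in \<open>n\<close> and \<open>k\<close> may be interchanged. The positive part \<open>max 0 t\<close> keeps the test function
  bounded on the negative half-line.
\<close>
lemma
  fixes M :: "real measure" and \<mu> :: "nat \<Rightarrow> real measure"
  assumes \<mu>: "\<And>n. real_distribution (\<mu> n)" and M: "real_distribution M" and conv: "weak_conv_m \<mu> M"
    and ab: "0 \<le> a" "a < b"
    and int: "\<And>n. integrable (\<mu> n) (\<lambda>t. exp (b * max 0 t))"
    and bd: "\<And>n. (\<integral>t. exp (b * max 0 t) \<partial>\<mu> n) \<le> B"
  shows integrable_weak_limit_exp: "integrable M (\<lambda>t. exp (a * max 0 t))"
    and tendsto_weak_limit_exp: "(\<lambda>n. \<integral>t. exp (a * max 0 t) \<partial>\<mu> n) \<longlonglongrightarrow> (\<integral>t. exp (a * max 0 t) \<partial>M)"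
proof -
  interpret \<mu>: real_distribution "\<mu> n" for n by (rule \<mu>)
  interpret M: real_distribution M by (rule M)
  define h where "h = (\<lambda>t. exp (a * max 0 t))"
  define hk where "hk = (\<lambda>(k::nat) t. exp (a * min (real k) (max 0 t)))"
  define H where "H = (\<lambda>t. exp (b * max 0 t))"
  have hk_le: "hk k t \<le> h t" and h_le: "h t \<le> H t" and hk_nonneg: "0 \<le> hk k t" for k t
    unfolding hk_def h_def H_def using ab by (auto intro!: mult_left_mono mult_right_mono)
  have hk_le': "hk k t \<le> exp (a * real k)" for k t
    using ab by (auto simp: hk_def intro!: mult_left_mono)
  have tail: "h t - hk k t \<le> exp (- ((b - a) * real k)) * H t" for k t
  proof (cases "max 0 t \<le> real k")
    case True
    then show ?thesis by (simp add: h_def hk_def H_def min_absorb2)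
  next
    case False
    have "h t - hk k t \<le> h t" using hk_nonneg[of k t] by simp
    also have "h t = exp (- ((b - a) * max 0 t)) * H t"
      by (simp add: h_def H_def algebra_simps flip: exp_add)
    also have "\<dots> \<le> exp (- ((b - a) * real k)) * H t"
      using False ab by (intro mult_right_mono) (auto simp: H_def intro!: mult_left_mono)
    finally show ?thesis .
  qed
  have meas: "h \<in> borel_measurable borel" "hk k \<in> borel_measurable borel" for k
    unfolding h_def hk_def by measurable
  have meas\<mu>: "h \<in> borel_measurable (\<mu> n)" "hk k \<in> borel_measurable (\<mu> n)" for n k
    using meas by (simp_all add: measurable_cong_sets[OF \<mu>.events_eq_borel refl])
  have measM: "h \<in> borel_measurable M" "hk k \<in> borel_measurable M" for k
    using meas by (simp_all add: measurable_cong_sets[OF M.events_eq_borel refl])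
  have int_h: "integrable (\<mu> n) h" for n
    by (rule Bochner_Integration.integrable_bound[OF int meas\<mu>(1)])
      (use h_le in \<open>auto simp: H_def h_def\<close>)
  have int_hk: "integrable (\<mu> n) (hk k)" for n k
    by (rule Bochner_Integration.integrable_bound[OF int_h meas\<mu>(2)])
      (use hk_le hk_nonneg order_trans in \<open>auto simp: h_def hk_def\<close>)
  have int_hkM: "integrable M (hk k)" for k
    by (rule M.integrable_const_bound[where B = "exp (a * real k)"])
      (use hk_le' hk_nonneg measM in auto)
  have B_h: "integral\<^sup>L (\<mu> n) h \<le> B" for n
    using integral_mono[OF int_h int, of n] h_le bd[of n] by (force simp: H_def)
  have lim_n: "(\<lambda>n. integral\<^sup>L (\<mu> n) (hk k)) \<longlonglongrightarrow> integral\<^sup>L M (hk k)" for k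
  proof (rule weak_conv_imp_integral_bdd_continuous_conv[OF \<mu> M conv])
    show "isCont (hk k) x" for x unfolding hk_def
      by (intro continuous_intros)
    show "norm (hk k x) \<le> exp (a * real k)" for x
      using hk_le'[of k x] hk_nonneg[of k x] by simp
  qed
  have mono_k: "hk k t \<le> hk l t" if "k \<le> l" for k l t
    unfolding hk_def using that ab by (auto intro!: mult_left_mono)
  have "incseq (\<lambda>k. integral\<^sup>L M (hk k))"
    by (auto simp: incseq_def intro!: integral_mono int_hkM mono_k)
  moreover have "integral\<^sup>L M (hk k) \<le> B" for k
  proof (rule tendsto_upperbound[OF lim_n])
    show "\<forall>\<^sub>F n in sequentially. integral\<^sup>L (\<mu> n) (hk k) \<le> B"
      by (intro always_eventually allI) (rule order_trans[OF integral_mono[OF int_hk int_h hk_le] B_h])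
  qed simp
  ultimately obtain L where L: "(\<lambda>k. integral\<^sup>L M (hk k)) \<longlonglongrightarrow> L"
    by (meson incseq_convergent)
  have AE_mono: "AE t in M. mono (\<lambda>k. hk k t)" by (simp add: mono_def mono_k)
  have "(\<lambda>k. hk k t) \<longlonglongrightarrow> h t" for t
  proof (rule tendsto_eventually)
    show "\<forall>\<^sub>F k in sequentially. hk k t = h t"
      using eventually_ge_at_top[of "nat \<lceil>max 0 t\<rceil>"]
    proof eventually_elim
      case (elim k)
      then have "max 0 t \<le> real k" by linarith
      then show ?case by (simp add: hk_def h_def min_absorb2)
    qed
  qed
  then have AE_lim: "AE t in M. (\<lambda>k. hk k t) \<longlonglongrightarrow> h t" by simp
  show "integrable M (\<lambda>t. exp (a * max 0 t))"
    using integrable_monotone_convergence[OF int_hkM AE_mono AE_lim L measM(1)] by (simp add: h_def)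
  have "L = integral\<^sup>L M h"
    using integral_monotone_convergence[OF int_hkM AE_mono AE_lim L measM(1)] by simp
  then have lim_k: "(\<lambda>k. integral\<^sup>L M (hk k)) \<longlonglongrightarrow> integral\<^sup>L M h" using L by simp
  have err: "\<bar>integral\<^sup>L (\<mu> n) (hk k) - integral\<^sup>L (\<mu> n) h\<bar> \<le> exp (- ((b - a) * real k)) * B" for k n
  proof -
    have "integral\<^sup>L (\<mu> n) h - integral\<^sup>L (\<mu> n) (hk k) = (\<integral>t. h t - hk k t \<partial>\<mu> n)"
      using int_h int_hk by simp
    also have "\<dots> \<le> (\<integral>t. exp (- ((b - a) * real k)) * H t \<partial>\<mu> n)"
      using int_h int_hk int tail by (intro integral_mono) (auto simp: H_def)
    also have "\<dots> \<le> exp (- ((b - a) * real k)) * B"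
      using bd[of n] by (simp add: H_def)
    finally show ?thesis using integral_mono[OF int_hk int_h hk_le, of n k] by simp
  qed
  have "uniform_limit UNIV (\<lambda>k n. integral\<^sup>L (\<mu> n) (hk k)) (\<lambda>n. integral\<^sup>L (\<mu> n) h) sequentially"
  proof (rule uniform_limitI)
    fix e :: real assume "e > 0"
    have "(\<lambda>k. exp (- ((b - a) * real k)) * B) \<longlonglongrightarrow> 0" using ab by real_asymp
    then have "\<forall>\<^sub>F k in sequentially. exp (- ((b - a) * real k)) * B < e"
      using \<open>e > 0\<close> by (rule order_tendstoD)
    then show "\<forall>\<^sub>F k in sequentially. \<forall>n\<in>UNIV. dist (integral\<^sup>L (\<mu> n) (hk k)) (integral\<^sup>L (\<mu> n) h) < e"
    proof eventually_elim
      case (elim k)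
      show ?case
      proof
        fix n
        show "dist (integral\<^sup>L (\<mu> n) (hk k)) (integral\<^sup>L (\<mu> n) h) < e"
          using err[of n k] elim by (simp add: dist_real_def)
      qed
    qed
  qed
  from swap_uniform_limit'[OF _ lim_k this, of sequentially]
  show "(\<lambda>n. \<integral>t. exp (a * max 0 t) \<partial>\<mu> n) \<longlonglongrightarrow> (\<integral>t. exp (a * max 0 t) \<partial>M)"
    using lim_n by (simp add: h_def)
qed

lemma AE_tilted_nonneg:
  assumes \<sigma>: "CM_measure \<sigma>"
  shows "AE t in tilted a \<sigma>. t \<ge> 0"
proof -
  have [measurable]: "(\<lambda>t. t) \<in> borel_measurable \<sigma>" by (rule CM_measure_measurable[OF \<sigma>]) simp
  show ?thesis unfolding tilted_def
    by (subst AE_distr_iff) (auto simp: AE_density CM_measure_space[OF \<sigma>])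
qed

lemma
  assumes \<sigma>: "CM_measure \<sigma>" and x: "0 < x"
  shows integrable_tilted_exp: "integrable (tilted x0 \<sigma>) (\<lambda>t. exp ((x0 - x) * max 0 t))"
    and integral_tilted_exp: "(\<integral>t. exp ((x0 - x) * max 0 t) \<partial>tilted x0 \<sigma>) = laplace \<sigma> x / laplace \<sigma> x0"
proof -
  have eq: "exp (- (x0 * t)) / laplace \<sigma> x0 * exp ((x0 - x) * max 0 t) = exp (- (x * t)) / laplace \<sigma> x0"
    if "t \<in> space \<sigma>" for t
    using that by (simp add: CM_measure_space[OF \<sigma>] max_absorb2 algebra_simps flip: exp_add)
  have m: "(\<lambda>t. exp ((x0 - x) * max 0 t)) \<in> borel_measurable borel" by measurable
  have "integrable \<sigma> (\<lambda>t. exp (- (x0 * t)) / laplace \<sigma> x0 * exp ((x0 - x) * max 0 t)) \<longleftrightarrow>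
      integrable \<sigma> (\<lambda>t. exp (- (x * t)) / laplace \<sigma> x0)"
    by (intro Bochner_Integration.integrable_cong refl eq)
  then show "integrable (tilted x0 \<sigma>) (\<lambda>t. exp ((x0 - x) * max 0 t))"
    using CM_measure_integrable[OF \<sigma> x] by (simp add: integrable_tilted[OF \<sigma> m])
  have "(\<integral>t. exp (- (x0 * t)) / laplace \<sigma> x0 * exp ((x0 - x) * max 0 t) \<partial>\<sigma>) =
      (\<integral>t. exp (- (x * t)) / laplace \<sigma> x0 \<partial>\<sigma>)"
    by (intro Bochner_Integration.integral_cong refl eq)
  then show "(\<integral>t. exp ((x0 - x) * max 0 t) \<partial>tilted x0 \<sigma>) = laplace \<sigma> x / laplace \<sigma> x0"
    by (simp add: integral_tilted[OF \<sigma> m] laplace_def)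
qed

text \<open>
  The measures tilted at \<open>x0\<close> are tight, because the bound at \<open>x0 / 2\<close> is a bound for an exponential
  moment. Untilting a weak limit gives \<open>\<sigma>\<close>. Convergence of the transforms at \<open>x\<close> is convergence of
  the moment of order \<open>x0 - x\<close>, which the bound at \<open>x / 2\<close> controls.
\<close>
lemma CM_measure_compactness:
  fixes \<tau> :: "nat \<Rightarrow> real measure"
  assumes \<tau>: "\<And>n. CM_measure (\<tau> n)" and c: "\<And>n. laplace (\<tau> n) x0 = c" "c > 0" and x0: "x0 > 0"
    and K: "\<And>n x. x > 0 \<Longrightarrow> laplace (\<tau> n) x \<le> K x"
  obtains \<sigma> r where "CM_measure \<sigma>" "strict_mono r"
    "\<And>x. 0 < x \<Longrightarrow> x \<le> x0 \<Longrightarrow> (\<lambda>n. laplace (\<tau> (r n)) x) \<longlonglongrightarrow> laplace \<sigma> x"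
proof -
  define \<mu> where "\<mu> = (\<lambda>n. tilted x0 (\<tau> n))"
  have rd: "real_distribution (\<mu> n)" for n
    unfolding \<mu>_def using \<tau> c x0 by (intro real_distribution_tilted) auto
  interpret \<mu>: real_distribution "\<mu> n" for n by (rule rd)
  have AE\<mu>: "AE t in \<mu> n. t \<ge> 0" for n unfolding \<mu>_def by (rule AE_tilted_nonneg[OF \<tau>])
  have int\<mu>: "integrable (\<mu> n) (\<lambda>t. exp ((x0 - x) * max 0 t))"
    and lap\<mu>: "(\<integral>t. exp ((x0 - x) * max 0 t) \<partial>\<mu> n) = laplace (\<tau> n) x / c" if "x > 0" for n x
    using integrable_tilted_exp[OF \<tau> that] integral_tilted_exp[OF \<tau> that] by (simp_all add: \<mu>_def c)
  have bd\<mu>: "(\<integral>t. exp ((x0 - x) * max 0 t) \<partial>\<mu> n) \<le> K x / c" if "x > 0" for n x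
    using K[OF that, of n] c(2) by (simp add: lap\<mu>[OF that] divide_right_mono)
  have "tight \<mu>"
    unfolding tight_def
  proof (intro conjI allI impI rd)
    fix e :: real assume e: "e > 0"
    define B where "B = K (x0 / 2) / c"
    have "((\<lambda>T. exp (- (x0 / 2 * T)) * B) \<longlongrightarrow> 0) at_top" using x0 by real_asymp
    then have "\<forall>\<^sub>F T in at_top. exp (- (x0 / 2 * T)) * B < e"
      using e by (rule order_tendstoD)
    then have "\<forall>\<^sub>F T in at_top. T \<ge> 0 \<and> exp (- (x0 / 2 * T)) * B < e"
      using eventually_ge_at_top[of 0] by eventually_elim simp
    then obtain T where T: "T \<ge> 0" "exp (- (x0 / 2 * T)) * B < e"
      by (auto simp: eventually_at_top_linorder)
    have "measure (\<mu> n) {-1<..T} > 1 - e" for n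
    proof -
      have "1 - measure (\<mu> n) {-1<..T} = measure (\<mu> n) (space (\<mu> n) - {-1<..T})"
        by (subst \<mu>.prob_compl) auto
      also have "\<dots> = (\<integral>t. indicator (space (\<mu> n) - {-1<..T}) t \<partial>\<mu> n)" by simp
      also have "\<dots> \<le> (\<integral>t. exp (- (x0 / 2 * T)) * exp ((x0 - x0 / 2) * max 0 t) \<partial>\<mu> n)"
      proof (rule integral_mono_AE)
        show "integrable (\<mu> n) (\<lambda>t. exp (- (x0 / 2 * T)) * exp ((x0 - x0 / 2) * max 0 t))"
          using int\<mu>[of "x0 / 2"] x0 by (intro integrable_mult_right) auto
        show "integrable (\<mu> n) (indicat_real (space (\<mu> n) - {-1<..T}))"
          by (intro \<mu>.integrable_const_bound[where B = 1]) auto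
        show "AE t in \<mu> n. indicat_real (space (\<mu> n) - {-1<..T}) t
            \<le> exp (- (x0 / 2 * T)) * exp ((x0 - x0 / 2) * max 0 t)"
          using AE\<mu>[of n]
        proof eventually_elim
          case (elim t)
          have "1 \<le> exp (- (x0 / 2 * T)) * exp ((x0 - x0 / 2) * max 0 t)" if "t > T"
            using that T x0 by (simp flip: exp_add)
          then show ?case using elim by (auto simp: indicator_def)
        qed
      qed
      also have "\<dots> \<le> exp (- (x0 / 2 * T)) * B"
        using mult_left_mono[OF bd\<mu>[of "x0 / 2" n], of "exp (- (x0 / 2 * T))"] x0 by (simp add: B_def)
      finally show ?thesis using T by simp
    qed
    then show "\<exists>a b. a < b \<and> (\<forall>n. 1 - e < measure (\<mu> n) {a<..b})"
      using T by (intro exI[of _ "-1"] exI[of _ T]) auto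
  qed
  from tight_imp_convergent_subsubsequence[OF this strict_mono_id]
  obtain r M where r: "strict_mono (r :: nat \<Rightarrow> nat)" and M: "real_distribution M"
    and conv: "weak_conv_m (\<mu> \<circ> r) M" by auto
  interpret M: real_distribution M by (rule M)
  have rd': "real_distribution ((\<mu> \<circ> r) n)" for n by (simp add: rd)
  have AE_M: "AE t in M. t \<ge> 0"
  proof -
    \<comment> \<open>a bounded continuous function that is positive exactly on the negative half-line\<close>
    define g where "g = (\<lambda>t::real. min 1 (max 0 (- t)))"
    have g_meas: "g \<in> borel_measurable M"
      by (simp add: measurable_cong_sets[OF M.events_eq_borel refl] g_def)
    have "(\<lambda>n. integral\<^sup>L ((\<mu> \<circ> r) n) g) \<longlonglongrightarrow> integral\<^sup>L M g"
    proof (rule weak_conv_imp_integral_bdd_continuous_conv[OF rd' M conv])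
      show "isCont g x" for x unfolding g_def by (intro continuous_intros)
      show "norm (g x) \<le> 1" for x by (auto simp: g_def)
    qed
    moreover have "integral\<^sup>L ((\<mu> \<circ> r) n) g = 0" for n
    proof -
      have "AE t in \<mu> (r n). g t = 0"
        using AE\<mu>[of "r n"] by eventually_elim (simp add: g_def)
      then show ?thesis by (simp add: integral_eq_zero_AE)
    qed
    ultimately have "integral\<^sup>L M g = 0" by (simp add: LIMSEQ_const_iff)
    moreover have "integrable M g"
      using g_meas by (intro M.integrable_const_bound[where B = 1]) (auto simp: g_def)
    ultimately have "AE t in M. g t = 0"
      by (subst (asm) integral_nonneg_eq_0_iff_AE) (auto simp: g_def)
    then show ?thesis by eventually_elim (auto simp: g_def min_def max_def split: if_splits)
  qed
  have limM: "integrable M (\<lambda>t. exp ((x0 - x) * max 0 t))"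
    "(\<lambda>n. \<integral>t. exp ((x0 - x) * max 0 t) \<partial>(\<mu> \<circ> r) n) \<longlonglongrightarrow> (\<integral>t. exp ((x0 - x) * max 0 t) \<partial>M)"
    if x: "0 < x" "x \<le> x0" for x
  proof -
    have b: "0 \<le> x0 - x" "x0 - x < x0 - x / 2" using x by auto
    have i: "integrable ((\<mu> \<circ> r) n) (\<lambda>t. exp ((x0 - x / 2) * max 0 t))"
      "(\<integral>t. exp ((x0 - x / 2) * max 0 t) \<partial>(\<mu> \<circ> r) n) \<le> K (x / 2) / c" for n
      using int\<mu>[of "x / 2" "r n"] bd\<mu>[of "x / 2" "r n"] x by auto
    show "integrable M (\<lambda>t. exp ((x0 - x) * max 0 t))"
      by (rule integrable_weak_limit_exp[OF rd' M conv b i])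
    show "(\<lambda>n. \<integral>t. exp ((x0 - x) * max 0 t) \<partial>(\<mu> \<circ> r) n) \<longlonglongrightarrow> (\<integral>t. exp ((x0 - x) * max 0 t) \<partial>M)"
      by (rule tendsto_weak_limit_exp[OF rd' M conv b i])
  qed
  define \<sigma> where "\<sigma> = density (restrict_space M {0..}) (\<lambda>t. ennreal (c * exp (x0 * t)))"
  have sets_RM: "sets (restrict_space M {0..}) = sets (restrict_space borel {0..})"
    by (rule sets_restrict_space_cong) simp
  have sets_\<sigma>: "sets \<sigma> = sets (restrict_space borel {0..})"
    by (simp add: \<sigma>_def sets_RM)
  have expm: "(\<lambda>t. exp (y * t)) \<in> borel_measurable (restrict_space M {0..})" for y :: real
    by (subst measurable_cong_sets[OF sets_RM refl]) (auto intro!: measurable_restrict_space1)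
  have expm': "(\<lambda>t. exp (- (y * t))) \<in> borel_measurable (restrict_space M {0..})" for y :: real
    using expm[of "- y"] by simp
  have cm: "(\<lambda>t. c * exp (x0 * t)) \<in> borel_measurable (restrict_space M {0..})"
    using expm[of x0] by measurable
  have A0: "{0..} \<inter> space M \<in> sets M" by simp
  have AEeq: "AE t in M. indicator {0..} t *\<^sub>R ((c * exp (x0 * t)) *\<^sub>R exp (- (x * t)))
      = c * exp ((x0 - x) * max 0 t)" for x
    using AE_M by eventually_elim (simp add: max_absorb2 algebra_simps flip: exp_add)
  have mm: "(\<lambda>t. indicator {0..} t *\<^sub>R ((c * exp (x0 * t)) *\<^sub>R exp (- (x * t)))) \<in> borel_measurable M"
    "(\<lambda>t. c * exp ((x0 - x) * max 0 t)) \<in> borel_measurable M" for x :: real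
    by (simp_all add: measurable_cong_sets[OF M.events_eq_borel refl])
  have int_iff: "integrable \<sigma> (\<lambda>t. exp (- (x * t))) \<longleftrightarrow> integrable M (\<lambda>t. c * exp ((x0 - x) * max 0 t))" for x
  proof -
    have "integrable \<sigma> (\<lambda>t. exp (- (x * t))) \<longleftrightarrow>
        integrable M (\<lambda>t. indicator {0..} t *\<^sub>R ((c * exp (x0 * t)) *\<^sub>R exp (- (x * t))))"
      unfolding \<sigma>_def using c expm' cm
      by (subst integrable_density) (auto simp: integrable_restrict_space[OF A0])
    also have "\<dots> \<longleftrightarrow> integrable M (\<lambda>t. c * exp ((x0 - x) * max 0 t))"
      by (rule integrable_cong_AE[OF mm AEeq])
    finally show ?thesis .
  qed
  have lap: "laplace \<sigma> x = c * (\<integral>t. exp ((x0 - x) * max 0 t) \<partial>M)" for x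
  proof -
    have "laplace \<sigma> x = (\<integral>t. indicator {0..} t *\<^sub>R ((c * exp (x0 * t)) *\<^sub>R exp (- (x * t))) \<partial>M)"
      unfolding laplace_def \<sigma>_def using c expm' cm
      by (subst integral_density) (auto simp: integral_restrict_space[OF A0])
    also have "\<dots> = (\<integral>t. c * exp ((x0 - x) * max 0 t) \<partial>M)"
      by (rule integral_cong_AE[OF mm AEeq])
    finally show ?thesis by simp
  qed
  have int_\<sigma>: "integrable \<sigma> (\<lambda>t. exp (- (x * t)))" if x: "x > 0" for x
  proof -
    have 1: "integrable \<sigma> (\<lambda>t. exp (- (min x x0 * t)))"
      unfolding int_iff using limM(1)[of "min x x0"] x x0 by (intro integrable_mult_right) auto
    show ?thesis
    proof (rule Bochner_Integration.integrable_bound[OF 1])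
      show "(\<lambda>t. exp (- (x * t))) \<in> borel_measurable \<sigma>"
        by (subst measurable_cong_sets[OF sets_\<sigma> refl]) (auto intro!: measurable_restrict_space1)
      have "space \<sigma> = {0..}"
        using sets_\<sigma>[THEN sets_eq_imp_space_eq] by (simp add: space_restrict_space)
      then show "AE t in \<sigma>. norm (exp (- (x * t))) \<le> norm (exp (- (min x x0 * t)))"
        by (intro AE_I2) (auto intro!: mult_right_mono)
    qed
  qed
  show thesis
  proof
    show "CM_measure \<sigma>" using int_\<sigma> by (simp add: CM_measure_def sets_\<sigma>)
    show "strict_mono r" by (rule r)
    fix x assume x: "0 < x" "x \<le> x0"
    have "(\<lambda>n. c * (\<integral>t. exp ((x0 - x) * max 0 t) \<partial>(\<mu> \<circ> r) n)) \<longlonglongrightarrow> laplace \<sigma> x"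
      unfolding lap by (intro tendsto_mult tendsto_const limM x)
    moreover have "c * (\<integral>t. exp ((x0 - x) * max 0 t) \<partial>(\<mu> \<circ> r) n) = laplace (\<tau> (r n)) x" for n
      using lap\<mu>[OF x(1), of "r n"] c(2) by simp
    ultimately show "(\<lambda>n. laplace (\<tau> (r n)) x) \<longlonglongrightarrow> laplace \<sigma> x" by simp
  qed
qed

text \<open>
  A decreasing function is at least its value at \<open>x\<close> on \<open>(0,x)\<close>.
\<close>
lemma laplace_le_L2:
  assumes \<sigma>: "CM_measure \<sigma>" and sq: "sq_integrable (laplace \<sigma>)" and x: "0 < x" "x \<le> 1"
  shows "x * (laplace \<sigma> x)\<^sup>2 \<le> inner2 (laplace \<sigma>) (laplace \<sigma>)"
proof -
  interpret finite_measure unit_interval by (rule finite_measure_unit_interval)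
  have A: "{0<..<x} \<in> sets unit_interval" using x by (auto simp: sets_restrict_space_iff)
  have m: "measure unit_interval {0<..<x} = x"
    using x by (subst measure_restrict_space) (auto simp: Int_absorb1)
  have sp: "{0<..<x} \<inter> space unit_interval = {0<..<x}"
    using x by (auto simp: space_restrict_space)
  have "x * (laplace \<sigma> x)\<^sup>2 = (\<integral>y. indicator {0<..<x} y * (laplace \<sigma> x)\<^sup>2 \<partial>unit_interval)"
    by (simp only: integral_mult_left_zero Bochner_Integration.integral_indicator sp m)
  also have "\<dots> \<le> (\<integral>y. (laplace \<sigma> y)\<^sup>2 \<partial>unit_interval)"
  proof (rule integral_mono)
    show "integrable unit_interval (\<lambda>y. indicator {0<..<x} y * (laplace \<sigma> x)\<^sup>2)"
      by (intro integrable_mult_left integrable_real_indicator A) (simp add: emeasure_eq_measure)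
    show "integrable unit_interval (\<lambda>y. (laplace \<sigma> y)\<^sup>2)" using sq by (simp add: sq_integrable_def)
    show "indicator {0<..<x} y * (laplace \<sigma> x)\<^sup>2 \<le> (laplace \<sigma> y)\<^sup>2" for y
      using laplace_antimono[OF \<sigma>, of y x] laplace_nonneg by (auto simp: indicator_def intro!: power_mono)
  qed
  finally show ?thesis by (simp add: inner2_def power2_eq_square)
qed

lemma Fatou_inner2:
  assumes u: "\<And>n. sq_integrable (u n)" and v: "v \<in> borel_measurable unit_interval"
    and lim: "\<And>x. x \<in> {0<..<1} \<Longrightarrow> (\<lambda>n. u n x) \<longlonglongrightarrow> v x"
    and bd: "\<And>n. inner2 (u n) (u n) \<le> b n" "b \<longlonglongrightarrow> \<beta>"
  shows "sq_integrable v \<and> inner2 v v \<le> \<beta>"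
proof -
  have b0: "b n \<ge> 0" for n using bd(1)[of n] inner2_self_nonneg[of "u n"] by linarith
  have \<beta>: "\<beta> \<ge> 0" by (rule tendsto_lowerbound[OF bd(2)]) (auto simp: b0)
  have "(\<integral>\<^sup>+x. ennreal ((v x)\<^sup>2) \<partial>unit_interval) = (\<integral>\<^sup>+x. liminf (\<lambda>n. ennreal ((u n x)\<^sup>2)) \<partial>unit_interval)"
  proof (intro nn_integral_cong)
    fix x assume "x \<in> space unit_interval"
    then have "(\<lambda>n. ennreal ((u n x)\<^sup>2)) \<longlonglongrightarrow> ennreal ((v x)\<^sup>2)"
      by (intro tendsto_ennrealI tendsto_power lim) (simp add: space_restrict_space)
    then show "ennreal ((v x)\<^sup>2) = liminf (\<lambda>n. ennreal ((u n x)\<^sup>2))"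
      by (rule lim_imp_Liminf[OF trivial_limit_sequentially, symmetric])
  qed
  also have "\<dots> \<le> liminf (\<lambda>n. \<integral>\<^sup>+x. ennreal ((u n x)\<^sup>2) \<partial>unit_interval)"
    using u by (intro nn_integral_liminf) (auto simp: sq_integrable_def)
  also have "\<dots> \<le> liminf (\<lambda>n. ennreal (b n))"
  proof (intro Liminf_mono always_eventually allI)
    fix n
    have "(\<integral>\<^sup>+x. ennreal ((u n x)\<^sup>2) \<partial>unit_interval) = ennreal (inner2 (u n) (u n))"
      using u[of n] by (subst nn_integral_eq_integral) (auto simp: sq_integrable_def inner2_def power2_eq_square)
    then show "(\<integral>\<^sup>+x. ennreal ((u n x)\<^sup>2) \<partial>unit_interval) \<le> ennreal (b n)"
      using bd(1)[of n] by (simp add: ennreal_leI)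
  qed
  also have "liminf (\<lambda>n. ennreal (b n)) = ennreal \<beta>"
    using bd(2) by (intro lim_imp_Liminf tendsto_ennrealI) auto
  finally have le: "(\<integral>\<^sup>+x. ennreal ((v x)\<^sup>2) \<partial>unit_interval) \<le> ennreal \<beta>" .
  have "integrable unit_interval (\<lambda>x. (v x)\<^sup>2)"
  proof (rule integrableI_nonneg)
    show "(\<integral>\<^sup>+x. ennreal ((v x)\<^sup>2) \<partial>unit_interval) < \<infinity>"
      using le by (rule le_less_trans) simp
  qed (use v in auto)
  then have sq: "sq_integrable v" using v by (simp add: sq_integrable_def)
  have "ennreal (inner2 v v) = (\<integral>\<^sup>+x. ennreal ((v x)\<^sup>2) \<partial>unit_interval)"
    using sq by (subst nn_integral_eq_integral) (auto simp: sq_integrable_def inner2_def power2_eq_square)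
  with le \<beta> sq show ?thesis by (metis ennreal_le_iff)
qed

definition admissible :: "real \<Rightarrow> real \<Rightarrow> real measure \<Rightarrow> bool" where
  "admissible x0 c \<tau> \<longleftrightarrow> CM_measure \<tau> \<and> sq_integrable (laplace \<tau>) \<and> laplace \<tau> x0 = c"

definition residual :: "(real \<Rightarrow> real) \<Rightarrow> real measure \<Rightarrow> real \<Rightarrow> real" where
  "residual \<phi> \<sigma> x = laplace \<sigma> x - \<phi> x"

definition misfit :: "(real \<Rightarrow> real) \<Rightarrow> real measure \<Rightarrow> real" where
  "misfit \<phi> \<sigma> = inner2 (residual \<phi> \<sigma>) (residual \<phi> \<sigma>)"

definition optimal :: "(real \<Rightarrow> real) \<Rightarrow> real \<Rightarrow> real \<Rightarrow> real measure \<Rightarrow> bool" where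
  "optimal \<phi> x0 c \<sigma> \<longleftrightarrow> admissible x0 c \<sigma> \<and> (\<forall>\<tau>. admissible x0 c \<tau> \<longrightarrow> misfit \<phi> \<sigma> \<le> misfit \<phi> \<tau>)"

lemma sq_integrable_laplace_mix:
  assumes "CM_measure \<sigma>" "CM_measure \<tau>" "a \<ge> 0" "b \<ge> 0"
    "sq_integrable (laplace \<sigma>)" "sq_integrable (laplace \<tau>)"
  shows "sq_integrable (laplace (mix a \<sigma> b \<tau>))"
  using sq_integrable_scale_add[OF assms(5,6), of a b] laplace_mix[OF assms(1-4)]
    sq_integrable_cong[of "laplace (mix a \<sigma> b \<tau>)" "\<lambda>x. a * laplace \<sigma> x + b * laplace \<tau> x"] by simp

text \<open>
  The extreme rays of the cone of completely monotone functions, scaled to meet the constraint. The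
  case \<open>t = 0\<close> shows that competitors exist; all \<open>t\<close> together are the test functions that yield the
  Caprini inequality.
\<close>
lemma admissible_exponential:
  assumes "t \<ge> 0" "c > 0" "x0 > 0"
  obtains \<tau> where "admissible x0 c \<tau>" "\<And>x. x > 0 \<Longrightarrow> laplace \<tau> x = c * exp (x0 * t) * exp (- (x * t))"
proof
  let ?\<tau> = "mix (c * exp (x0 * t)) (point_mass t) 0 (point_mass t)"
  note pm = CM_measure_point_mass[OF assms(1)]
  have "sq_integrable (laplace (point_mass t))"
    unfolding laplace_point_mass[OF assms(1), abs_def]
    using assms by (intro sq_integrable_bounded[where B = 1]) auto
  then have "sq_integrable (laplace ?\<tau>)"
    using assms by (intro sq_integrable_laplace_mix pm) auto
  moreover show lap: "laplace ?\<tau> x = c * exp (x0 * t) * exp (- (x * t))" if "x > 0" for x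
    using assms that by (simp add: laplace_mix pm laplace_point_mass)
  ultimately show "admissible x0 c ?\<tau>"
    using assms by (simp add: admissible_def CM_measure_mix pm exp_minus)
qed

text \<open>
  The direct method: \<open>laplace_le_L2\<close> bounds a minimizing sequence pointwise, a subsequence converges
  by \<open>CM_measure_compactness\<close>, and Fatou's lemma gives lower semicontinuity of the misfit.
\<close>
lemma minimizer_exists:
  assumes \<phi>: "sq_integrable \<phi>" and c: "c > 0" and x0: "x0 \<ge> 1"
  shows "\<exists>\<sigma>. optimal \<phi> x0 c \<sigma>"
proof -
  define m where "m = Inf (misfit \<phi> ` Collect (admissible x0 c))"
  have ne: "misfit \<phi> ` Collect (admissible x0 c) \<noteq> {}"
    using admissible_exponential[of 0 c x0] c x0 by auto
  have bdd: "bdd_below (misfit \<phi> ` Collect (admissible x0 c))"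
    by (rule bdd_belowI[of _ 0]) (auto simp: misfit_def inner2_self_nonneg)
  have "\<exists>\<tau>. admissible x0 c \<tau> \<and> misfit \<phi> \<tau> < m + inverse (real (Suc n))" for n
    using cInf_lessD[OF ne, of "m + inverse (real (Suc n))"] by (auto simp: m_def)
  then obtain \<tau> where \<tau>: "\<And>n. admissible x0 c (\<tau> n)" "\<And>n. misfit \<phi> (\<tau> n) < m + inverse (real (Suc n))"
    by metis
  have \<tau>': "CM_measure (\<tau> n)" "sq_integrable (laplace (\<tau> n))" "laplace (\<tau> n) x0 = c" for n
    using \<tau>(1)[of n] by (auto simp: admissible_def)
  define B where "B = 2 * (m + 1) + 2 * inner2 \<phi> \<phi>"
  have B: "inner2 (laplace (\<tau> n)) (laplace (\<tau> n)) \<le> B" for n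
  proof -
    let ?f = "laplace (\<tau> n)"
    have d: "sq_integrable (\<lambda>x. ?f x - \<phi> x)" by (intro sq_integrable_diff \<tau>' \<phi>)
    have "inner2 ?f ?f \<le> (\<integral>x. 2 * ((?f x - \<phi> x) * (?f x - \<phi> x)) + 2 * (\<phi> x * \<phi> x) \<partial>unit_interval)"
      unfolding inner2_def
    proof (rule integral_mono)
      \<comment> \<open>twice the squared residual plus \<open>2 \<phi>\<^sup>2\<close> exceeds the square of the transform by this square\<close>
      have "0 \<le> (?f x - 2 * \<phi> x)\<^sup>2" for x by simp
      then show "?f x * ?f x \<le> 2 * ((?f x - \<phi> x) * (?f x - \<phi> x)) + 2 * (\<phi> x * \<phi> x)" for x
        by (simp add: power2_eq_square algebra_simps)
    qed (use sq_integrable_mult[OF \<tau>'(2) \<tau>'(2)] sq_integrable_mult[OF d d] sq_integrable_mult[OF \<phi> \<phi>] in auto)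
    also have "\<dots> = 2 * misfit \<phi> (\<tau> n) + 2 * inner2 \<phi> \<phi>"
      using sq_integrable_mult[OF d d] sq_integrable_mult[OF \<phi> \<phi>] by (simp add: misfit_def residual_def inner2_def)
    also have "misfit \<phi> (\<tau> n) \<le> m + 1"
      using \<tau>(2)[of n] inverse_le_1_iff[of "real (Suc n)"] by simp
    finally show ?thesis by (simp add: B_def)
  qed
  have K: "laplace (\<tau> n) x \<le> sqrt (B / min x 1)" if x: "x > 0" for n x
  proof -
    have "laplace (\<tau> n) x \<le> laplace (\<tau> n) (min x 1)"
      using x by (intro laplace_antimono \<tau>') auto
    also have "min x 1 * (laplace (\<tau> n) (min x 1))\<^sup>2 \<le> B"
      using laplace_le_L2[OF \<tau>'(1,2), of "min x 1" n] x B[of n] by simp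
    then have "(laplace (\<tau> n) (min x 1))\<^sup>2 \<le> B / min x 1"
      using x by (simp add: pos_le_divide_eq mult.commute)
    then have "laplace (\<tau> n) (min x 1) \<le> sqrt (B / min x 1)" by (rule real_le_rsqrt)
    finally show ?thesis .
  qed
  obtain \<sigma> r where \<sigma>: "CM_measure \<sigma>" and r: "strict_mono r"
    and lim: "\<And>x. 0 < x \<Longrightarrow> x \<le> x0 \<Longrightarrow> (\<lambda>n. laplace (\<tau> (r n)) x) \<longlonglongrightarrow> laplace \<sigma> x"
    using CM_measure_compactness[of \<tau> x0 c "\<lambda>x. sqrt (B / min x 1)"] \<tau>' c x0 K by auto
  have meas: "laplace \<sigma> \<in> borel_measurable unit_interval"
    by (intro measurable_unit_interval laplace_measurable \<sigma>)
  have sq: "sq_integrable (laplace \<sigma>)"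
    using Fatou_inner2[of "\<lambda>n. laplace (\<tau> (r n))" "laplace \<sigma>" "\<lambda>_. B" B] \<tau>' meas lim B x0 by auto
  have "laplace \<sigma> x0 = c"
    using lim[of x0] x0 by (simp add: \<tau>' LIMSEQ_const_iff)
  then have adm: "admissible x0 c \<sigma>" using \<sigma> sq by (simp add: admissible_def)
  have "sq_integrable (\<lambda>x. laplace \<sigma> x - \<phi> x) \<and> misfit \<phi> \<sigma> \<le> m"
    unfolding misfit_def residual_def[abs_def]
  proof (rule Fatou_inner2[of "\<lambda>n x. laplace (\<tau> (r n)) x - \<phi> x"])
    show "sq_integrable (\<lambda>x. laplace (\<tau> (r n)) x - \<phi> x)" for n by (intro sq_integrable_diff \<tau>' \<phi>)
    show "(\<lambda>x. laplace \<sigma> x - \<phi> x) \<in> borel_measurable unit_interval"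
      using meas sq_integrable_measurable[OF \<phi>] by measurable
    show "(\<lambda>n. laplace (\<tau> (r n)) x - \<phi> x) \<longlonglongrightarrow> laplace \<sigma> x - \<phi> x" if "x \<in> {0<..<1}" for x
      using that x0 by (intro tendsto_diff lim tendsto_const) auto
    show "inner2 (\<lambda>x. laplace (\<tau> (r n)) x - \<phi> x) (\<lambda>x. laplace (\<tau> (r n)) x - \<phi> x)
        \<le> m + inverse (real (Suc (r n)))" for n
      using \<tau>(2)[of "r n"] by (simp add: misfit_def residual_def[abs_def])
    have "(\<lambda>n. m + inverse (real (Suc n))) \<longlonglongrightarrow> m + 0"
      by (intro tendsto_intros LIMSEQ_inverse_real_of_nat)
    from LIMSEQ_subseq_LIMSEQ[OF this r]
    show "(\<lambda>n. m + inverse (real (Suc (r n)))) \<longlonglongrightarrow> m" by (simp add: o_def)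
  qed
  then have "misfit \<phi> \<sigma> \<le> misfit \<phi> \<tau>" if "admissible x0 c \<tau>" for \<tau>
    using cInf_lower[OF _ bdd, of "misfit \<phi> \<tau>"] that by (auto simp: m_def)
  with adm show ?thesis by (auto simp: optimal_def)
qed

lemma sq_integrable_residual:
  "sq_integrable (laplace \<sigma>) \<Longrightarrow> sq_integrable \<phi> \<Longrightarrow> sq_integrable (residual \<phi> \<sigma>)"
  unfolding residual_def[abs_def] by (rule sq_integrable_diff)

section \<open>The variational inequality and uniqueness\<close>

lemma misfit_expand:
  assumes "sq_integrable (laplace \<sigma>)" "sq_integrable (laplace \<tau>)" "sq_integrable \<phi>"
  shows "misfit \<phi> \<tau> = misfit \<phi> \<sigma>
      + 2 * (inner2 (laplace \<tau>) (residual \<phi> \<sigma>) - inner2 (laplace \<sigma>) (residual \<phi> \<sigma>))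
      + inner2 (\<lambda>x. laplace \<tau> x - laplace \<sigma> x) (\<lambda>x. laplace \<tau> x - laplace \<sigma> x)"
proof -
  let ?g = "residual \<phi> \<sigma>" and ?h = "\<lambda>x. laplace \<sigma> x - laplace \<tau> x"
  note sq = sq_integrable_residual[OF assms(1,3)] sq_integrable_diff[OF assms(1,2)] sq_integrable_diff[OF assms(2,1)]
  have "misfit \<phi> \<tau> = inner2 (\<lambda>x. ?g x - ?h x) (\<lambda>x. ?g x - ?h x)"
    by (simp add: misfit_def residual_def[abs_def])
  also have "\<dots> = misfit \<phi> \<sigma> - 2 * inner2 ?g ?h + inner2 ?h ?h"
    unfolding misfit_def by (rule inner2_diff_self[OF sq(1,2)])
  also have "inner2 ?g ?h = inner2 (laplace \<sigma>) ?g - inner2 (laplace \<tau>) ?g"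
    unfolding inner2_commute[of ?g] by (rule inner2_diff[OF assms(1,2) sq(1)])
  also have "inner2 ?h ?h = inner2 (\<lambda>x. laplace \<tau> x - laplace \<sigma> x) (\<lambda>x. laplace \<tau> x - laplace \<sigma> x)"
    by (simp add: inner2_def algebra_simps)
  finally show ?thesis by simp
qed

text \<open>
  Along the segment from \<open>\<sigma>\<close> to \<open>\<tau>\<close> the misfit is a convex quadratic polynomial, so it is minimal at
  the start exactly if its derivative there is nonnegative.
\<close>
lemma optimal_iff_variational:
  assumes \<phi>: "sq_integrable \<phi>" and x0: "x0 > 0"
  shows "optimal \<phi> x0 c \<sigma> \<longleftrightarrow> admissible x0 c \<sigma> \<and>
    (\<forall>\<tau>. admissible x0 c \<tau> \<longrightarrow> inner2 (laplace \<sigma>) (residual \<phi> \<sigma>) \<le> inner2 (laplace \<tau>) (residual \<phi> \<sigma>))"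
proof (intro iffI conjI allI impI)
  assume opt: "optimal \<phi> x0 c \<sigma>"
  then show "admissible x0 c \<sigma>" by (simp add: optimal_def)
  then have \<sigma>: "CM_measure \<sigma>" "sq_integrable (laplace \<sigma>)" "laplace \<sigma> x0 = c" by (simp_all add: admissible_def)
  fix \<tau> assume "admissible x0 c \<tau>"
  then have \<tau>: "CM_measure \<tau>" "sq_integrable (laplace \<tau>)" "laplace \<tau> x0 = c" by (simp_all add: admissible_def)
  let ?g = "residual \<phi> \<sigma>" and ?h = "\<lambda>x. laplace \<tau> x - laplace \<sigma> x"
  have g: "sq_integrable ?g" by (rule sq_integrable_residual[OF \<sigma>(2) \<phi>])
  define A where "A = inner2 (laplace \<tau>) ?g - inner2 (laplace \<sigma>) ?g"
  have "2 * A + e * inner2 ?h ?h \<ge> 0" if e: "0 < e" "e < 1" for e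
  proof -
    let ?\<rho> = "mix (1 - e) \<sigma> e \<tau>"
    have e': "0 \<le> 1 - e" "0 \<le> e" using e by auto
    have lap: "laplace ?\<rho> x = (1 - e) * laplace \<sigma> x + e * laplace \<tau> x" if "x > 0" for x
      using laplace_mix[OF \<sigma>(1) \<tau>(1) e' that] .
    have sq: "sq_integrable (laplace ?\<rho>)" by (rule sq_integrable_laplace_mix[OF \<sigma>(1) \<tau>(1) e' \<sigma>(2) \<tau>(2)])
    have "admissible x0 c ?\<rho>"
      unfolding admissible_def using CM_measure_mix[OF \<sigma>(1) \<tau>(1) e'] sq lap[OF x0]
      by (simp add: \<sigma> \<tau> algebra_simps)
    then have "misfit \<phi> \<sigma> \<le> misfit \<phi> ?\<rho>" using opt by (simp add: optimal_def)
    then have "0 \<le> 2 * (inner2 (laplace ?\<rho>) ?g - inner2 (laplace \<sigma>) ?g)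
        + inner2 (\<lambda>x. laplace ?\<rho> x - laplace \<sigma> x) (\<lambda>x. laplace ?\<rho> x - laplace \<sigma> x)"
      unfolding misfit_expand[OF \<sigma>(2) sq \<phi>] by simp
    also have "inner2 (laplace ?\<rho>) ?g = inner2 (\<lambda>x. (1 - e) * laplace \<sigma> x + e * laplace \<tau> x) ?g"
      by (rule inner2_cong) (auto simp: lap)
    also have "\<dots> = (1 - e) * inner2 (laplace \<sigma>) ?g + e * inner2 (laplace \<tau>) ?g"
      by (rule inner2_scale_add[OF \<sigma>(2) \<tau>(2) g])
    also have "inner2 (\<lambda>x. laplace ?\<rho> x - laplace \<sigma> x) (\<lambda>x. laplace ?\<rho> x - laplace \<sigma> x)
        = inner2 (\<lambda>x. e * ?h x) (\<lambda>x. e * ?h x)"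
      by (rule inner2_cong) (auto simp: lap algebra_simps)
    also have "\<dots> = e * e * inner2 ?h ?h"
      unfolding inner2_def by (simp add: mult_ac flip: integral_mult_right_zero)
    finally have "0 \<le> e * (2 * A + e * inner2 ?h ?h)" by (simp add: A_def algebra_simps)
    then show ?thesis using e by (simp add: zero_le_mult_iff)
  qed
  then have "\<forall>\<^sub>F e in at_right 0. 0 \<le> 2 * A + e * inner2 ?h ?h"
    by (auto simp: eventually_at_right_field intro!: exI[of _ 1])
  moreover have "((\<lambda>e. 2 * A + e * inner2 ?h ?h) \<longlongrightarrow> 2 * A + 0 * inner2 ?h ?h) (at_right 0)"
    by (intro tendsto_intros)
  ultimately have "0 \<le> 2 * A + 0 * inner2 ?h ?h" by (intro tendsto_lowerbound) auto
  then show "inner2 (laplace \<sigma>) ?g \<le> inner2 (laplace \<tau>) ?g" by (simp add: A_def)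
next
  assume *: "admissible x0 c \<sigma> \<and>
    (\<forall>\<tau>. admissible x0 c \<tau> \<longrightarrow> inner2 (laplace \<sigma>) (residual \<phi> \<sigma>) \<le> inner2 (laplace \<tau>) (residual \<phi> \<sigma>))"
  have "misfit \<phi> \<sigma> \<le> misfit \<phi> \<tau>" if \<tau>: "admissible x0 c \<tau>" for \<tau>
  proof -
    have "misfit \<phi> \<tau> = misfit \<phi> \<sigma>
      + 2 * (inner2 (laplace \<tau>) (residual \<phi> \<sigma>) - inner2 (laplace \<sigma>) (residual \<phi> \<sigma>))
      + inner2 (\<lambda>x. laplace \<tau> x - laplace \<sigma> x) (\<lambda>x. laplace \<tau> x - laplace \<sigma> x)"
      using * \<tau> \<phi> by (intro misfit_expand) (auto simp: admissible_def)
    then show ?thesis using * \<tau> inner2_self_nonneg[of "\<lambda>x. laplace \<tau> x - laplace \<sigma> x"] by auto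
  qed
  then show "optimal \<phi> x0 c \<sigma>" using * by (simp add: optimal_def)
qed

lemma isCont_laplace:
  assumes "CM_measure \<sigma>" "x > 0"
  shows "isCont (laplace \<sigma>) x"
proof -
  let ?F = "\<lambda>z. \<integral>t. exp (- (z * complex_of_real t)) \<partial>\<sigma>"
  have "isCont ?F (complex_of_real x)"
    using holomorphic_on_imp_continuous_on[OF laplace_complex_holomorphic[OF assms(1)]] assms(2)
    by (simp add: continuous_on_eq_continuous_at open_halfspace_Re_gt)
  then have "isCont (\<lambda>x. ?F (complex_of_real x)) x"
    by (rule isCont_o2[rotated]) simp
  then have "isCont (\<lambda>x. Re (?F (complex_of_real x))) x" by (rule isCont_Re)
  then show ?thesis by (simp only: laplace_complex_of_real Re_complex_of_real eta_contract_eq)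
qed

text \<open>
  The set where two continuous transforms differ is open; if it is a null set, it is empty.
\<close>
lemma CM_measure_eq_if_L2_dist_zero:
  assumes \<sigma>: "CM_measure \<sigma>" "sq_integrable (laplace \<sigma>)" and \<tau>: "CM_measure \<tau>" "sq_integrable (laplace \<tau>)"
    and zero: "inner2 (\<lambda>x. laplace \<sigma> x - laplace \<tau> x) (\<lambda>x. laplace \<sigma> x - laplace \<tau> x) \<le> 0"
  shows "\<sigma> = \<tau>"
proof (rule laplace_unique[OF \<sigma>(1) \<tau>(1)])
  let ?d = "\<lambda>x. laplace \<sigma> x - laplace \<tau> x"
  let ?N = "{x \<in> {0<..<1}. ?d x \<noteq> 0}"
  have d: "sq_integrable ?d" by (rule sq_integrable_diff[OF \<sigma>(2) \<tau>(2)])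
  have "inner2 ?d ?d = 0" using zero inner2_self_nonneg by (rule antisym)
  then have "integral\<^sup>L unit_interval (\<lambda>x. ?d x * ?d x) = 0" by (simp only: inner2_def)
  then have "AE x in unit_interval. ?d x * ?d x = 0"
    by (subst (asm) integral_nonneg_eq_0_iff_AE[OF sq_integrable_mult[OF d d]]) auto
  then have AE: "AE x in lborel. x \<notin> ?N"
    by (subst (asm) AE_restrict_space_iff) auto
  have cont: "continuous_on {0<..<1} ?d"
    by (intro continuous_at_imp_continuous_on ballI isCont_diff isCont_laplace \<sigma> \<tau>) auto
  have "?N = {0<..<1} \<inter> ?d -` (- {0})" by auto
  then have op: "open ?N"
    using continuous_open_preimage[OF cont, of "- {0}"] by (simp only: open_greaterThanLessThan open_Compl closed_singleton)
  then have "?N \<in> sets lborel" by simp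
  then have "?N \<in> null_sets lborel" using AE by (subst AE_iff_null_sets)
  then have "negligible ?N" by (simp add: negligible_iff_null_sets null_sets_completionI)
  then have "?N = {}" using open_not_negligible[OF op] by blast
  then show "laplace \<sigma> x = laplace \<tau> x" if "x \<in> {0<..<1}" for x using that by auto
qed

lemma optimal_unique:
  assumes \<phi>: "sq_integrable \<phi>" and x0: "x0 > 0" and opt: "optimal \<phi> x0 c \<sigma>" "optimal \<phi> x0 c \<tau>"
  shows "\<sigma> = \<tau>"
proof -
  have \<sigma>: "CM_measure \<sigma>" "sq_integrable (laplace \<sigma>)" and \<tau>: "CM_measure \<tau>" "sq_integrable (laplace \<tau>)"
    using opt by (auto simp: optimal_def admissible_def)
  have "misfit \<phi> \<sigma> = misfit \<phi> \<tau>" using opt by (auto simp: optimal_def intro: antisym)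
  moreover have "inner2 (laplace \<tau>) (residual \<phi> \<tau>) \<le> inner2 (laplace \<sigma>) (residual \<phi> \<tau>)"
    using opt optimal_iff_variational[OF \<phi> x0] unfolding optimal_def by blast
  ultimately have "inner2 (\<lambda>x. laplace \<sigma> x - laplace \<tau> x) (\<lambda>x. laplace \<sigma> x - laplace \<tau> x) \<le> 0"
    using misfit_expand[OF \<tau>(2) \<sigma>(2) \<phi>] by simp
  then show ?thesis by (rule CM_measure_eq_if_L2_dist_zero[OF \<sigma> \<tau>])
qed

section \<open>The Caprini function and the first-order conditions\<close>

lemma unit_laplace_complex_holomorphic:
  assumes g: "integrable unit_interval g"
  shows "(\<lambda>z. \<integral>x. exp (- (z * complex_of_real x)) * of_real (g x) \<partial>unit_interval) holomorphic_on UNIV"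
proof (rule holomorphic_onI)
  fix z :: complex
  have int: "integrable unit_interval (\<lambda>x. exp (r * \<bar>x\<bar>) * \<bar>g x\<bar>)" if "0 \<le> r" for r
  proof (rule Bochner_Integration.integrable_bound)
    show "integrable unit_interval (\<lambda>x. exp r * g x)" using g by simp
    have [measurable]: "(\<lambda>x. x) \<in> borel_measurable unit_interval" "g \<in> borel_measurable unit_interval"
      using g by (auto intro: measurable_unit_interval)
    show "(\<lambda>x. exp (r * \<bar>x\<bar>) * \<bar>g x\<bar>) \<in> borel_measurable unit_interval" by measurable
    show "AE x in unit_interval. norm (exp (r * \<bar>x\<bar>) * \<bar>g x\<bar>) \<le> norm (exp r * g x)"
    proof (rule AE_I2)
      fix x assume "x \<in> space unit_interval"
      then have "r * \<bar>x\<bar> \<le> r"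
        using that by (intro mult_left_le) (auto simp: space_restrict_space)
      then show "norm (exp (r * \<bar>x\<bar>) * \<bar>g x\<bar>) \<le> norm (exp r * g x)"
        by (simp add: abs_mult mult_right_mono)
    qed
  qed
  have "(\<lambda>z. \<integral>x. exp (- ((z - 0) * complex_of_real x)) * of_real (g x) \<partial>unit_interval)
      holomorphic_on ball 0 (norm z + 1)"
    using g int by (intro holomorphic_exp_integral) (auto intro: measurable_unit_interval)
  then show "(\<lambda>z. \<integral>x. exp (- (z * complex_of_real x)) * of_real (g x) \<partial>unit_interval)
      field_differentiable at z within UNIV"
    by (simp add: holomorphic_on_imp_differentiable_at)
qed

lemma unit_laplace_complex_of_real:
  "(\<integral>x. exp (- (complex_of_real t * complex_of_real x)) * of_real (g x) \<partial>unit_interval)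
    = complex_of_real (unit_laplace g t)"
proof -
  have "exp (- (complex_of_real t * complex_of_real x)) * of_real (g x)
      = complex_of_real (exp (- (x * t)) * g x)" for x
    unfolding of_real_mult exp_of_real[symmetric] by (simp add: mult.commute)
  then show ?thesis unfolding unit_laplace_def by (simp only: integral_complex_of_real)
qed

lemma continuous_unit_laplace:
  assumes "integrable unit_interval g"
  shows "continuous_on S (unit_laplace g)"
proof -
  let ?F = "\<lambda>z. \<integral>x. exp (- (z * complex_of_real x)) * of_real (g x) \<partial>unit_interval"
  have cont: "continuous_on UNIV ?F"
    by (rule holomorphic_on_imp_continuous_on[OF unit_laplace_complex_holomorphic[OF assms]])
  have "continuous_on S (\<lambda>t. Re (?F (complex_of_real t)))"
    by (rule continuous_on_Re[OF continuous_on_compose2[OF cont continuous_on_of_real[OF continuous_on_id]]]) simp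
  then show ?thesis by (simp only: unit_laplace_complex_of_real Re_complex_of_real eta_contract_eq)
qed

text \<open>
  By the Lindelof property the complement of the support is a countable union of open null sets.
\<close>
lemma AE_in_msupport:
  assumes \<sigma>: "CM_measure \<sigma>"
  shows "AE t in \<sigma>. t \<in> msupport \<sigma>"
proof -
  let ?F = "{U. open U \<and> emeasure \<sigma> (U \<inter> {0..}) = 0}"
  obtain F' where F': "F' \<subseteq> ?F" "countable F'" "\<Union>F' = \<Union>?F"
    using Lindelof[of ?F] by auto
  have "(\<Union>U\<in>F'. U \<inter> {0..}) \<in> null_sets \<sigma>"
  proof (rule null_sets_UN'[OF F'(2)])
    fix U assume "U \<in> F'"
    then have "open U" "emeasure \<sigma> (U \<inter> {0..}) = 0" using F'(1) by auto
    moreover from this have "U \<inter> {0..} \<in> sets \<sigma>"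
      by (simp add: CM_measure_sets[OF \<sigma>] sets_restrict_space_iff)
    ultimately show "U \<inter> {0..} \<in> null_sets \<sigma>" by (simp add: null_setsI)
  qed
  then have "AE t in \<sigma>. t \<notin> (\<Union>U\<in>F'. U \<inter> {0..})" by (rule AE_not_in)
  moreover have "AE t in \<sigma>. t \<ge> 0" by (rule CM_measure_AE_nonneg[OF \<sigma>])
  ultimately show ?thesis
  proof eventually_elim
    case (elim t)
    then have "t \<notin> \<Union>?F" using F'(3) by blast
    then have "emeasure \<sigma> (U \<inter> {0..}) \<noteq> 0" if "open U" "t \<in> U" for U using that by blast
    then show ?case using elim by (auto simp: msupport_def zero_less_iff_neq_zero)
  qed
qed

lemma AE_zero_imp_zero_on_msupport:
  assumes \<sigma>: "CM_measure \<sigma>" and cont: "continuous_on {0..} h" and AE: "AE t in \<sigma>. h t = (0::real)"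
    and t: "t \<in> msupport \<sigma>"
  shows "h t = 0"
proof (rule ccontr)
  assume "h t \<noteq> 0"
  have "openin (top_of_set {0..}) ({0..} \<inter> h -` (- {0}))"
    using cont continuous_openin_preimage_gen[of "{0..}" h "- {0}"] by auto
  then obtain U where U: "open U" "{0..} \<inter> h -` (- {0}) = U \<inter> {0..}"
    by (auto simp: openin_open Int_commute)
  have "t \<ge> 0" using t by (simp add: msupport_def)
  then have "t \<in> U" using U(2) \<open>h t \<noteq> 0\<close> by blast
  then have "emeasure \<sigma> (U \<inter> {0..}) > 0" using t U(1) by (auto simp: msupport_def)
  moreover have "AE s in \<sigma>. \<not> s \<in> U \<inter> {0..}"
    using AE by eventually_elim (use U(2) in auto)
  then have "emeasure \<sigma> {s \<in> space \<sigma>. s \<in> U \<inter> {0..}} = 0" by (rule emeasure_eq_0_AE)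
  moreover have "{s \<in> space \<sigma>. s \<in> U \<inter> {0..}} = U \<inter> {0..}" by (auto simp: CM_measure_space[OF \<sigma>])
  ultimately show False by simp
qed

text \<open>
  The inequality is the variational inequality for the exponential with exponent \<open>t\<close>. The integrals of
  its two sides against \<open>\<sigma>\<close> agree by the constraint, so equality holds almost everywhere, and by
  continuity on the whole support.
\<close>
lemma
  assumes \<phi>: "sq_integrable \<phi>" and x0: "x0 > 0" and c: "c > 0" and opt: "optimal \<phi> x0 c \<sigma>"
  shows optimal_caprini_ge: "t \<ge> 0 \<Longrightarrow>
      exp (- (x0 * t)) / c * inner2 (laplace \<sigma>) (residual \<phi> \<sigma>) \<le> unit_laplace (residual \<phi> \<sigma>) t"
    and optimal_caprini_eq: "t \<in> msupport \<sigma> \<Longrightarrow>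
      unit_laplace (residual \<phi> \<sigma>) t = exp (- (x0 * t)) / c * inner2 (laplace \<sigma>) (residual \<phi> \<sigma>)"
proof -
  let ?g = "residual \<phi> \<sigma>"
  define I where "I = inner2 (laplace \<sigma>) ?g"
  have \<sigma>: "CM_measure \<sigma>" "sq_integrable (laplace \<sigma>)" "laplace \<sigma> x0 = c"
    using opt by (auto simp: optimal_def admissible_def)
  have g: "sq_integrable ?g" by (rule sq_integrable_residual[OF \<sigma>(2) \<phi>])
  have ge: "exp (- (x0 * t)) / c * I \<le> unit_laplace ?g t" if t: "t \<ge> 0" for t
  proof -
    obtain \<tau> where \<tau>: "admissible x0 c \<tau>"
      and lap: "\<And>x. x > 0 \<Longrightarrow> laplace \<tau> x = c * exp (x0 * t) * exp (- (x * t))"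
      using admissible_exponential[OF t c x0] by auto
    have "I \<le> inner2 (laplace \<tau>) ?g"
      using opt \<tau> unfolding optimal_iff_variational[OF \<phi> x0] I_def by blast
    also have "\<dots> = inner2 (\<lambda>x. c * exp (x0 * t) * exp (- (x * t))) ?g"
      by (rule inner2_cong) (auto simp: lap)
    also have "\<dots> = c * exp (x0 * t) * unit_laplace ?g t"
      by (simp add: inner2_def unit_laplace_def mult.assoc)
    finally show ?thesis using c by (simp add: exp_minus field_simps)
  qed
  have int: "integrable \<sigma> (\<lambda>t. unit_laplace ?g t - exp (- (x0 * t)) / c * I)"
    using integrable_unit_laplace[OF \<sigma>(1,2) g] CM_measure_integrable[OF \<sigma>(1) x0]
    by (intro Bochner_Integration.integrable_diff integrable_mult_left) auto
  have "(\<integral>t. unit_laplace ?g t - exp (- (x0 * t)) / c * I \<partial>\<sigma>) = I - laplace \<sigma> x0 / c * I"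
    using integrable_unit_laplace[OF \<sigma>(1,2) g] CM_measure_integrable[OF \<sigma>(1) x0]
    by (simp add: integral_unit_laplace[OF \<sigma>(1,2) g] I_def laplace_def)
  also have "\<dots> = 0" using c \<sigma>(3) by simp
  finally have "AE t in \<sigma>. unit_laplace ?g t - exp (- (x0 * t)) / c * I = 0"
    using ge CM_measure_AE_nonneg[OF \<sigma>(1)]
    by (subst (asm) integral_nonneg_eq_0_iff_AE[OF int]) (auto elim!: eventually_mono)
  then have eq: "unit_laplace ?g t - exp (- (x0 * t)) / c * I = 0" if "t \<in> msupport \<sigma>" for t
    using that
    by (rule AE_zero_imp_zero_on_msupport[OF \<sigma>(1), rotated])
       (use c in \<open>intro continuous_intros continuous_unit_laplace sq_integrable_integrable[OF g], auto\<close>)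
  show "t \<ge> 0 \<Longrightarrow> exp (- (x0 * t)) / c * inner2 (laplace \<sigma>) ?g \<le> unit_laplace ?g t"
    using ge by (simp add: I_def)
  show "t \<in> msupport \<sigma> \<Longrightarrow> unit_laplace ?g t = exp (- (x0 * t)) / c * inner2 (laplace \<sigma>) ?g"
    using eq by (simp add: I_def)
qed

section \<open>The support of the minimizer\<close>

text \<open>
  By analytic continuation the identity extends to negative \<open>t\<close>. At \<open>t = - n\<close>, multiplied by
  \<open>exp (- n)\<close>, its left side tends to 0 by dominated convergence, since \<open>x < 1\<close> in the integral,
  while its right side has modulus \<open>\<bar>l\<bar> exp ((x0 - 1) n) \<ge> \<bar>l\<bar>\<close>.
\<close>
lemma unit_laplace_eq_exponential_imp_zero:
  assumes g: "integrable unit_interval g" and x0: "x0 \<ge> 1"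
    and eq: "\<And>t. t \<ge> 0 \<Longrightarrow> unit_laplace g t = l * exp (- (x0 * t))"
  shows "l = 0"
proof -
  let ?F = "\<lambda>z. (\<integral>x. exp (- (z * complex_of_real x)) * of_real (g x) \<partial>unit_interval)
      - of_real l * exp (- (of_real x0 * z))"
  have F_real: "?F (of_real t) = of_real (unit_laplace g t - l * exp (- (x0 * t)))" for t
    by (simp add: unit_laplace_complex_of_real flip: exp_of_real)
  have "?F z = 0" for z
  proof (rule analytic_continuation[of ?F UNIV "complex_of_real ` {0<..<1}" "of_real (1/2)"])
    show "?F holomorphic_on UNIV"
      by (intro holomorphic_intros unit_laplace_complex_holomorphic g)
    show "complex_of_real (1/2) islimpt complex_of_real ` {0<..<1}"
    proof (rule islimpt_isCont_image)
      show "(1/2::real) islimpt {0<..<1}"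
        by (intro interior_limit_point) (auto simp: interior_open)
      show "\<forall>\<^sub>F y in at (1 / 2). complex_of_real y \<noteq> complex_of_real (1 / 2)"
        unfolding of_real_eq_iff by (simp add: eventually_at_filter)
    qed auto
    show "?F v = 0" if "v \<in> complex_of_real ` {0<..<1}" for v
    proof -
      from that obtain x where "x \<in> {0<..<1}" and v: "v = of_real x" by blast
      then show ?thesis unfolding v F_real using eq[of x] by simp
    qed
  qed auto
  then have "complex_of_real (unit_laplace g t - l * exp (- (x0 * t))) = 0" for t
    unfolding F_real[symmetric] .
  then have all: "unit_laplace g t = l * exp (- (x0 * t))" for t
    by (simp only: of_real_eq_0_iff right_minus_eq)
  have [measurable]: "(\<lambda>x. x) \<in> borel_measurable unit_interval" "g \<in> borel_measurable unit_interval"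
    using g by (auto intro: measurable_unit_interval)
  have "(\<lambda>n. \<integral>x. exp (- (real n * (1 - x))) * g x \<partial>unit_interval) \<longlonglongrightarrow> (\<integral>x. 0 \<partial>unit_interval)"
  proof (rule integral_dominated_convergence[where w = "\<lambda>x. \<bar>g x\<bar>"])
    show "AE x in unit_interval. (\<lambda>n. exp (- (real n * (1 - x))) * g x) \<longlonglongrightarrow> 0"
    proof (rule AE_I2)
      fix x assume "x \<in> space unit_interval"
      then have "1 - x > 0" by (simp add: space_restrict_space)
      then show "(\<lambda>n. exp (- (real n * (1 - x))) * g x) \<longlonglongrightarrow> 0" by real_asymp
    qed
    show "AE x in unit_interval. norm (exp (- (real n * (1 - x))) * g x) \<le> \<bar>g x\<bar>" for n
      by (intro AE_I2) (auto simp: abs_mult space_restrict_space intro!: mult_left_le_one_le)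
  qed (use g in auto)
  moreover have "(\<integral>x. exp (- (real n * (1 - x))) * g x \<partial>unit_interval) = exp (- real n) * unit_laplace g (- real n)" for n
  proof -
    have "exp (- (real n * (1 - x))) * g x = exp (- real n) * (exp (- (x * - real n)) * g x)" for x
      by (simp add: algebra_simps flip: exp_add mult.assoc)
    then show ?thesis by (simp only: unit_laplace_def integral_mult_right_zero)
  qed
  ultimately have lim: "(\<lambda>n. exp (- real n) * (l * exp (x0 * real n))) \<longlonglongrightarrow> 0"
    by (simp add: all)
  have "(\<lambda>n. \<bar>exp (- real n) * (l * exp (x0 * real n))\<bar>) \<longlonglongrightarrow> 0"
    using tendsto_rabs[OF lim] by simp
  moreover have "\<bar>l\<bar> \<le> \<bar>exp (- real n) * (l * exp (x0 * real n))\<bar>" for n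
  proof -
    have "1 \<le> exp (- real n) * exp (x0 * real n)"
      using mult_right_mono[OF x0, of "real n"] by (simp flip: exp_add)
    from mult_left_mono[OF this, of "\<bar>l\<bar>"] show ?thesis by (simp add: abs_mult mult_ac)
  qed
  ultimately have "\<bar>l\<bar> \<le> 0" by (intro tendsto_lowerbound) auto
  then show "l = 0" by simp
qed

text \<open>
  Bounded partial sums of \<open>1 / (1 + t)\<close> make the support countable. In any enumeration all but
  finitely many points exceed 1, and for these \<open>1 / t \<le> 2 / (1 + t)\<close>.
\<close>
lemma finite_or_S_supportI:
  assumes nonneg: "\<And>t. t \<in> msupport \<sigma> \<Longrightarrow> t \<ge> 0"
    and bd: "\<And>F. finite F \<Longrightarrow> F \<subseteq> msupport \<sigma> \<Longrightarrow> (\<Sum>t\<in>F. 1 / (1 + t)) \<le> K"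
  shows "finite_or_S_support \<sigma>"
proof (cases "finite (msupport \<sigma>)")
  case False
  let ?Z = "msupport \<sigma>"
  have "(\<lambda>t. 1 / (1 + t)) summable_on ?Z"
    using nonneg bd by (intro nonneg_bounded_partial_sums_imp_summable_on[where C = K]) (auto intro: always_eventually eventually_finite_subsets_at_top_weakI)
  then have "countable {t \<in> ?Z. 1 / (1 + t) \<noteq> 0}" by (rule summable_countable_real)
  also have "{t \<in> ?Z. 1 / (1 + t) \<noteq> 0} = ?Z" using nonneg by force
  finally have cnt: "countable ?Z" .
  define e where "e = from_nat_into ?Z"
  have e: "bij_betw e UNIV ?Z" unfolding e_def by (rule bij_betw_from_nat_into[OF cnt False])
  have e_in: "e n \<in> ?Z" for n using e by (auto simp: bij_betw_def)
  have sum: "summable (\<lambda>n. 1 / (1 + e n))"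
  proof (rule summableI_nonneg_bounded)
    show "0 \<le> 1 / (1 + e n)" for n using nonneg[OF e_in[of n]] by simp
    show "(\<Sum>i<n. 1 / (1 + e i)) \<le> K" for n
    proof -
      have "inj_on e {..<n}" using e by (auto simp: bij_betw_def intro: inj_on_subset)
      then have "(\<Sum>i<n. 1 / (1 + e i)) = (\<Sum>t\<in>e ` {..<n}. 1 / (1 + t))" by (simp add: sum.reindex)
      also have "\<dots> \<le> K" using e_in by (intro bd) auto
      finally show ?thesis .
    qed
  qed
  have "\<forall>\<^sub>F n in sequentially. 1 / (1 + e n) < 1 / 2"
    using summable_LIMSEQ_zero[OF sum] by (rule order_tendstoD) simp
  then have "\<forall>\<^sub>F n in sequentially. norm (1 / e n) \<le> 2 * (1 / (1 + e n))"
  proof eventually_elim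
    case (elim n)
    then have "e n > 1" using nonneg[OF e_in[of n]] by (simp add: field_simps)
    then show ?case by (simp add: field_simps)
  qed
  then have "summable (\<lambda>n. 1 / e n)"
    by (rule summable_comparison_test_ev) (intro summable_mult sum)
  moreover have "bij_betw (\<lambda>n. n - Suc 0) {1..} UNIV"
    by (rule bij_betw_byWitness[where f' = Suc]) auto
  then have "bij_betw (e \<circ> (\<lambda>n. n - Suc 0)) {1..} ?Z"
    using e by (rule bij_betw_trans)
  ultimately show ?thesis unfolding finite_or_S_support_def
    by (intro disjI2 exI[of _ "e \<circ> (\<lambda>n. n - Suc 0)"]) simp
qed (simp add: finite_or_S_support_def)

text \<open>
  The support consists of zeros of \<open>G\<close>, the analytic continuation of the difference of the two sides of
  the Caprini inequality. If \<open>G\<close> vanished on \<open>[0,\<infinity>)\<close>, then \<open>l = 0\<close> and the residual would be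
  orthogonal to every square-integrable transform, in particular to itself, which forces \<open>\<sigma> = \<sigma>0\<close> and
  contradicts \<open>c \<noteq> f0 x0\<close>.
\<close>
lemma optimal_support:
  assumes \<sigma>0: "represents \<sigma>0 f0" and f0: "sq_integrable f0" and x0: "x0 \<ge> 1" and c: "c > 0" "c \<noteq> f0 x0"
    and opt: "optimal f0 x0 c \<sigma>"
  shows "finite_or_S_support \<sigma>"
proof -
  let ?g = "residual f0 \<sigma>"
  have \<sigma>: "CM_measure \<sigma>" "sq_integrable (laplace \<sigma>)" "laplace \<sigma> x0 = c"
    using opt by (auto simp: optimal_def admissible_def)
  have g: "sq_integrable ?g" by (rule sq_integrable_residual[OF \<sigma>(2) f0])
  note g1 = sq_integrable_integrable[OF g]
  have rep: "CM_measure \<sigma>0" "\<And>x. x > 0 \<Longrightarrow> f0 x = laplace \<sigma>0 x"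
    using \<sigma>0 by (auto simp: represents_def)
  have sq0: "sq_integrable (laplace \<sigma>0)" using f0 sq_integrable_cong[of f0 "laplace \<sigma>0"] rep by auto
  define l where "l = inner2 (laplace \<sigma>) ?g / c"
  define G where "G = (\<lambda>z. (\<integral>x. exp (- (z * complex_of_real x)) * of_real (?g x) \<partial>unit_interval)
      - of_real l * exp (- (of_real x0 * z)))"
  have G_real: "G (of_real t) = of_real (unit_laplace ?g t - l * exp (- (x0 * t)))" for t
    by (simp add: G_def unit_laplace_complex_of_real flip: exp_of_real)
  have "\<exists>s\<ge>0. G (of_real s) \<noteq> 0"
  proof (rule ccontr)
    assume *: "\<not> (\<exists>s\<ge>0. G (of_real s) \<noteq> 0)"
    have eq: "unit_laplace ?g t = l * exp (- (x0 * t))" if "t \<ge> 0" for t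
    proof -
      have "complex_of_real (unit_laplace ?g t - l * exp (- (x0 * t))) = 0"
        using * that by (simp only: G_real[symmetric]) blast
      then show ?thesis by (simp only: of_real_eq_0_iff right_minus_eq)
    qed
    have "l = 0" by (rule unit_laplace_eq_exponential_imp_zero[OF g1 x0 eq])
    then have zero: "unit_laplace ?g t = 0" if "t \<ge> 0" for t using eq[OF that] by simp
    have "inner2 (laplace \<tau>) ?g = 0" if "CM_measure \<tau>" "sq_integrable (laplace \<tau>)" for \<tau>
    proof -
      have "inner2 (laplace \<tau>) ?g = (\<integral>t. unit_laplace ?g t \<partial>\<tau>)"
        by (rule integral_unit_laplace[OF that g, symmetric])
      also have "\<dots> = (\<integral>t. 0 \<partial>\<tau>)"
        by (intro Bochner_Integration.integral_cong refl zero) (simp add: CM_measure_space[OF that(1)])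
      finally show ?thesis by simp
    qed
    then have "inner2 (\<lambda>x. laplace \<sigma> x - laplace \<sigma>0 x) ?g = 0"
      using inner2_diff[OF \<sigma>(2) sq0 g] \<sigma> rep sq0 by simp
    moreover have "inner2 (\<lambda>x. laplace \<sigma> x - laplace \<sigma>0 x) ?g
        = inner2 (\<lambda>x. laplace \<sigma> x - laplace \<sigma>0 x) (\<lambda>x. laplace \<sigma> x - laplace \<sigma>0 x)"
      by (rule inner2_cong) (auto simp: residual_def rep)
    ultimately have "\<sigma> = \<sigma>0"
      by (intro CM_measure_eq_if_L2_dist_zero \<sigma> rep sq0) simp
    then show False using \<sigma>(3) rep(2)[of x0] x0 c(2) by simp
  qed
  then obtain s where s: "s \<ge> 0" "G (of_real s) \<noteq> 0" by blast
  define B where "B = exp 1 * (\<integral>x. \<bar>?g x\<bar> \<partial>unit_interval) + \<bar>l\<bar> * exp x0"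
  have bound: "norm (G z) \<le> B" if z: "Re z > -1" for z
  proof -
    have "norm (\<integral>x. exp (- (z * complex_of_real x)) * of_real (?g x) \<partial>unit_interval)
        \<le> (\<integral>x. exp 1 * \<bar>?g x\<bar> \<partial>unit_interval)"
    proof (rule order_trans[OF integral_norm_bound integral_mono_AE'])
      show "integrable unit_interval (\<lambda>x. exp 1 * \<bar>?g x\<bar>)" using g1 by simp
      show "AE x in unit_interval. norm (exp (- (z * complex_of_real x)) * of_real (?g x)) \<le> exp 1 * \<bar>?g x\<bar>"
      proof (rule AE_I2)
        fix x assume "x \<in> space unit_interval"
        then have x: "0 < x" "x < 1" by (auto simp: space_restrict_space)
        have "- Re z * x \<le> 1 * 1" using z x
          by (smt (verit) mult_left_le mult_le_cancel_right_pos mult_minus_left)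
        then show "norm (exp (- (z * complex_of_real x)) * of_real (?g x)) \<le> exp 1 * \<bar>?g x\<bar>"
          by (auto simp: norm_mult intro!: mult_right_mono)
      qed
    qed simp
    moreover have "norm (of_real l * exp (- (of_real x0 * z))) \<le> \<bar>l\<bar> * exp x0"
    proof -
      have "- (x0 * Re z) \<le> x0" using z x0 mult_left_mono[of "-1" "Re z" x0] by simp
      then show ?thesis by (auto simp: norm_mult intro!: mult_left_mono)
    qed
    ultimately show ?thesis unfolding G_def B_def
      by (intro order_trans[OF norm_triangle_ineq4] add_mono) auto
  qed
  have holo: "G holomorphic_on {z. Re z > -1}"
    unfolding G_def
    by (rule holomorphic_on_subset[of _ UNIV])
       (auto intro!: holomorphic_intros unit_laplace_complex_holomorphic g1)
  show ?thesis
  proof (rule finite_or_S_supportI)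
    show "t \<ge> 0" if "t \<in> msupport \<sigma>" for t using that by (simp add: msupport_def)
    fix F assume F: "finite F" "F \<subseteq> msupport \<sigma>"
    show "(\<Sum>t\<in>F. 1 / (1 + t)) \<le> (s + 2) / 2 * ln (B / norm (G (of_real s)))"
    proof (rule sum_zeros_half_plane_bound[OF holo bound s F(1)])
      fix t assume "t \<in> F"
      then have t: "t \<in> msupport \<sigma>" using F by blast
      have "unit_laplace ?g t = l * exp (- (x0 * t))"
        using optimal_caprini_eq[OF f0 _ c(1) opt t] x0 by (simp add: l_def)
      then show "t \<ge> 0 \<and> G (of_real t) = 0"
        using t by (simp add: G_real msupport_def)
    qed
  qed
qed

section \<open>Sufficiency of the Caprini condition\<close>

text \<open>
  The number \<open>I\<close> below decides whether the constraint can be recovered: the equality on the support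
  integrates to \<open>I = I * laplace \<sigma> x0 / c\<close>, and \<open>I = 0\<close> is possible only for \<open>\<sigma> = \<sigma>0\<close>.
\<close>
lemma caprini_condition_imp_optimal:
  assumes \<sigma>0: "represents \<sigma>0 f0" and f0: "sq_integrable f0" and x0: "x0 > 0" and c: "c > 0"
    and \<sigma>: "CM_measure \<sigma>" "sq_integrable (laplace \<sigma>)" "\<sigma> \<noteq> \<sigma>0"
    and ge: "\<And>t. t \<ge> 0 \<Longrightarrow>
      exp (- (x0 * t)) / c * inner2 (laplace \<sigma>) (residual f0 \<sigma>) \<le> unit_laplace (residual f0 \<sigma>) t"
    and eq: "\<And>t. t \<in> msupport \<sigma> \<Longrightarrow>
      unit_laplace (residual f0 \<sigma>) t = exp (- (x0 * t)) / c * inner2 (laplace \<sigma>) (residual f0 \<sigma>)"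
  shows "optimal f0 x0 c \<sigma>"
proof -
  let ?g = "residual f0 \<sigma>"
  define I where "I = inner2 (laplace \<sigma>) ?g"
  have g: "sq_integrable ?g" by (rule sq_integrable_residual[OF \<sigma>(2) f0])
  have rep: "CM_measure \<sigma>0" "\<And>x. x > 0 \<Longrightarrow> f0 x = laplace \<sigma>0 x"
    using \<sigma>0 by (auto simp: represents_def)
  have sq0: "sq_integrable (laplace \<sigma>0)" using f0 sq_integrable_cong[of f0 "laplace \<sigma>0"] rep by auto
  have lower: "laplace \<tau> x0 / c * I \<le> inner2 (laplace \<tau>) ?g"
    if "CM_measure \<tau>" "sq_integrable (laplace \<tau>)" for \<tau>
  proof -
    have "laplace \<tau> x0 / c * I = (\<integral>t. exp (- (x0 * t)) / c * I \<partial>\<tau>)" by (simp add: laplace_def)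
    also have "\<dots> \<le> (\<integral>t. unit_laplace ?g t \<partial>\<tau>)"
      using integrable_unit_laplace[OF that g] CM_measure_integrable[OF that(1) x0] ge CM_measure_AE_nonneg[OF that(1)]
      by (intro integral_mono_AE integrable_mult_left) (auto simp: I_def elim!: eventually_mono)
    finally show ?thesis by (simp add: integral_unit_laplace[OF that g])
  qed
  have I_eq: "I = laplace \<sigma> x0 / c * I"
  proof -
    have meas: "unit_laplace ?g \<in> borel_measurable \<sigma>" "(\<lambda>t. exp (- (x0 * t)) / c * I) \<in> borel_measurable \<sigma>"
      using integrable_unit_laplace[OF \<sigma>(1,2) g] by (auto intro!: CM_measure_measurable[OF \<sigma>(1)])
    have "I = (\<integral>t. unit_laplace ?g t \<partial>\<sigma>)" by (simp add: I_def integral_unit_laplace[OF \<sigma>(1,2) g])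
    also have "\<dots> = (\<integral>t. exp (- (x0 * t)) / c * I \<partial>\<sigma>)"
      using AE_in_msupport[OF \<sigma>(1)] eq by (intro integral_cong_AE meas) (auto simp: I_def elim!: eventually_mono)
    finally show ?thesis by (simp add: laplace_def)
  qed
  have "I \<noteq> 0"
  proof
    assume "I = 0"
    then have "inner2 (\<lambda>x. laplace \<sigma> x - laplace \<sigma>0 x) ?g \<le> 0"
      using lower[OF rep(1) sq0] inner2_diff[OF \<sigma>(2) sq0 g] by (simp add: I_def)
    moreover have "inner2 (\<lambda>x. laplace \<sigma> x - laplace \<sigma>0 x) ?g
        = inner2 (\<lambda>x. laplace \<sigma> x - laplace \<sigma>0 x) (\<lambda>x. laplace \<sigma> x - laplace \<sigma>0 x)"
      by (rule inner2_cong) (auto simp: residual_def rep)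
    ultimately show False
      using CM_measure_eq_if_L2_dist_zero[OF \<sigma>(1,2) rep(1) sq0] \<sigma>(3) by simp
  qed
  then have "laplace \<sigma> x0 = c" using I_eq c by (simp add: field_simps)
  then have "admissible x0 c \<sigma>" using \<sigma> by (simp add: admissible_def)
  moreover have "I \<le> inner2 (laplace \<tau>) ?g" if "admissible x0 c \<tau>" for \<tau>
    using lower[of \<tau>] that c by (simp add: admissible_def)
  ultimately show ?thesis
    unfolding optimal_iff_variational[OF f0 x0] I_def by blast
qed

section \<open>The theorem\<close>

lemma norm_L2_squared: "(norm_L2 f)\<^sup>2 = inner2 f f"
  by (simp add: norm_L2_def set_integral_unit_interval inner2_def power2_eq_square)

lemma C2_iff:
  assumes "represents \<sigma> f"
  shows "f \<in> C2 \<longleftrightarrow> sq_integrable (laplace \<sigma>)"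
proof -
  have "laplace \<sigma> \<in> borel_measurable unit_interval"
    using assms by (intro measurable_unit_interval laplace_measurable) (simp add: represents_def)
  moreover have "integrable unit_interval (\<lambda>x. (f x)\<^sup>2) \<longleftrightarrow> integrable unit_interval (\<lambda>x. (laplace \<sigma> x)\<^sup>2)"
    using assms by (intro Bochner_Integration.integrable_cong) (auto simp: represents_def space_restrict_space)
  ultimately show ?thesis
    using assms by (auto simp: C2_def CM_def set_integrable_unit_interval sq_integrable_def)
qed

lemma represents_laplace: "CM_measure \<sigma> \<Longrightarrow> represents \<sigma> (laplace \<sigma>)"
  by (simp add: represents_def)

lemma is_minimizer_iff_optimal:
  assumes x0: "x0 > 0"
  shows "is_minimizer f0 x0 \<delta> \<sigma> \<longleftrightarrow> optimal f0 x0 (f0 x0 + \<delta>) \<sigma>"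
proof -
  have adm: "CM_measure \<tau> \<and> laplace \<tau> \<in> feasible f0 x0 \<delta> \<longleftrightarrow> admissible x0 (f0 x0 + \<delta>) \<tau>" for \<tau>
    using C2_iff[OF represents_laplace, of \<tau>] by (auto simp: feasible_def admissible_def)
  have feas: "\<exists>\<tau>. admissible x0 (f0 x0 + \<delta>) \<tau> \<and> (norm_L2 (\<lambda>x. f x - f0 x))\<^sup>2 = misfit f0 \<tau>"
    if f: "f \<in> feasible f0 x0 \<delta>" for f
  proof -
    obtain \<tau> where \<tau>: "represents \<tau> f" using f by (auto simp: feasible_def C2_def CM_def)
    then have "admissible x0 (f0 x0 + \<delta>) \<tau>"
      using f x0 C2_iff[OF \<tau>] by (auto simp: feasible_def admissible_def represents_def)
    moreover have "(norm_L2 (\<lambda>x. f x - f0 x))\<^sup>2 = misfit f0 \<tau>"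
      unfolding norm_L2_squared misfit_def using \<tau>
      by (intro inner2_cong) (auto simp: represents_def residual_def)
    ultimately show ?thesis by blast
  qed
  have norm: "(norm_L2 (\<lambda>x. laplace \<tau> x - f0 x))\<^sup>2 = misfit f0 \<tau>" for \<tau>
    by (simp add: norm_L2_squared misfit_def residual_def[abs_def])
  have "(\<forall>f\<in>feasible f0 x0 \<delta>. misfit f0 \<sigma> \<le> (norm_L2 (\<lambda>x. f x - f0 x))\<^sup>2) \<longleftrightarrow>
      (\<forall>\<tau>. admissible x0 (f0 x0 + \<delta>) \<tau> \<longrightarrow> misfit f0 \<sigma> \<le> misfit f0 \<tau>)" (is "?L \<longleftrightarrow> ?R")
  proof
    assume ?L
    show ?R
    proof (intro allI impI)
      fix \<tau> assume "admissible x0 (f0 x0 + \<delta>) \<tau>"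
      then have "laplace \<tau> \<in> feasible f0 x0 \<delta>" using adm by blast
      from bspec[OF \<open>?L\<close> this] show "misfit f0 \<sigma> \<le> misfit f0 \<tau>" by (simp only: norm)
    qed
  next
    assume ?R
    show ?L
    proof
      fix f assume "f \<in> feasible f0 x0 \<delta>"
      from feas[OF this] obtain \<tau> where "admissible x0 (f0 x0 + \<delta>) \<tau>"
        "(norm_L2 (\<lambda>x. f x - f0 x))\<^sup>2 = misfit f0 \<tau>" by blast
      with \<open>?R\<close> show "misfit f0 \<sigma> \<le> (norm_L2 (\<lambda>x. f x - f0 x))\<^sup>2" by simp
    qed
  qed
  then show ?thesis
    unfolding is_minimizer_def optimal_def norm using adm[of \<sigma>] by blast
qed

lemma caprini_eq: "caprini f0 \<sigma> t = unit_laplace (residual f0 \<sigma>) t"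
  by (simp add: caprini_def unit_laplace_def residual_def set_integral_unit_interval)

lemma caprini_bound_eq:
  "caprini_bound f0 x0 \<delta> \<sigma> t = exp (- (x0 * t)) / (f0 x0 + \<delta>) * inner2 (laplace \<sigma>) (residual f0 \<sigma>)"
  by (simp add: caprini_bound_def inner2_def residual_def set_integral_unit_interval)

theorem theorem7p1:
  fixes f0 :: "real \<Rightarrow> real" and \<sigma>0 :: "real measure" and x0 :: real
  assumes "f0 \<in> C2" and "represents \<sigma>0 f0" and "x0 \<ge> 1"
  shows "\<exists>\<delta>m>0. \<exists>\<delta>p>0. \<forall>\<delta>\<in>{-\<delta>m<..<\<delta>p}. ((\<forall>x>0. f0 x = 0) \<longrightarrow> \<delta> > 0) \<longrightarrow>
     (\<exists>!\<sigma>. is_minimizer f0 x0 \<delta> \<sigma>) \<and>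
     (\<forall>\<sigma>. is_minimizer f0 x0 \<delta> \<sigma> \<longrightarrow>
        (\<delta> \<noteq> 0 \<longrightarrow> finite_or_S_support \<sigma>) \<and> caprini_condition f0 x0 \<delta> \<sigma>) \<and>
     (\<forall>\<sigma>. CM_measure \<sigma> \<and> laplace \<sigma> \<in> C2 \<and> finite_or_S_support \<sigma> \<and>
        caprini_condition f0 x0 \<delta> \<sigma> \<and> \<sigma> \<noteq> \<sigma>0 \<longrightarrow> is_minimizer f0 x0 \<delta> \<sigma>)"
    (is "\<exists>\<delta>m>0. \<exists>\<delta>p>0. \<forall>\<delta>\<in>{-\<delta>m<..<\<delta>p}. ?Q \<delta>")
proof -
  have x0: "x0 > 0" using assms(3) by simp
  have rep: "CM_measure \<sigma>0" "\<And>x. x > 0 \<Longrightarrow> f0 x = laplace \<sigma>0 x"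
    using assms(2) by (auto simp: represents_def)
  have f0: "sq_integrable f0"
    using assms(1) C2_iff[OF assms(2)] sq_integrable_cong[of f0 "laplace \<sigma>0"] rep by auto
  define \<delta>m where "\<delta>m = (if f0 x0 > 0 then f0 x0 else 1)"
  have concl: "(\<exists>!\<sigma>. is_minimizer f0 x0 \<delta> \<sigma>) \<and>
     (\<forall>\<sigma>. is_minimizer f0 x0 \<delta> \<sigma> \<longrightarrow>
        (\<delta> \<noteq> 0 \<longrightarrow> finite_or_S_support \<sigma>) \<and> caprini_condition f0 x0 \<delta> \<sigma>) \<and>
     (\<forall>\<sigma>. CM_measure \<sigma> \<and> laplace \<sigma> \<in> C2 \<and> finite_or_S_support \<sigma> \<and>
        caprini_condition f0 x0 \<delta> \<sigma> \<and> \<sigma> \<noteq> \<sigma>0 \<longrightarrow> is_minimizer f0 x0 \<delta> \<sigma>)"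
    if \<delta>: "\<delta> \<in> {-\<delta>m<..<1}" "(\<forall>x>0. f0 x = 0) \<longrightarrow> \<delta> > 0" for \<delta>
  proof -
    have c: "f0 x0 + \<delta> > 0"
    proof (cases "f0 x0 > 0")
      case True
      then show ?thesis using \<delta>(1) by (simp add: \<delta>m_def)
    next
      case False
      then have zero: "laplace \<sigma>0 x0 = 0" using rep(2)[OF x0] laplace_nonneg[of \<sigma>0 x0] by simp
      have "f0 x = 0" if "x > 0" for x
      proof -
        have "AE t in \<sigma>0. False"
          using laplace_zero_imp_null[OF rep(1) x0 zero, of "space \<sigma>0"] by (intro AE_I[of _ _ "space \<sigma>0"]) auto
        then have "laplace \<sigma>0 x = 0" unfolding laplace_def by (intro integral_eq_zero_AE) auto
        then show ?thesis using rep(2)[OF that] by simp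
      qed
      then show ?thesis using \<delta>(2) zero rep(2)[OF x0] by simp
    qed
    note opt_iff = is_minimizer_iff_optimal[OF x0, of f0 \<delta>]
    have "\<exists>\<sigma>. optimal f0 x0 (f0 x0 + \<delta>) \<sigma>" by (rule minimizer_exists[OF f0 c assms(3)])
    then have "\<exists>!\<sigma>. is_minimizer f0 x0 \<delta> \<sigma>"
      unfolding opt_iff using optimal_unique[OF f0 x0] by blast
    moreover have "caprini_condition f0 x0 \<delta> \<sigma>" if "is_minimizer f0 x0 \<delta> \<sigma>" for \<sigma>
      unfolding caprini_condition_def caprini_eq caprini_bound_eq
      using optimal_caprini_ge[OF f0 x0 c that[unfolded opt_iff]]
        optimal_caprini_eq[OF f0 x0 c that[unfolded opt_iff]] by blast
    moreover have "finite_or_S_support \<sigma>" if "is_minimizer f0 x0 \<delta> \<sigma>" "\<delta> \<noteq> 0" for \<sigma>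
      using optimal_support[OF assms(2) f0 assms(3) c _ that(1)[unfolded opt_iff]] that(2) by simp
    moreover have "is_minimizer f0 x0 \<delta> \<sigma>"
      if "CM_measure \<sigma>" "laplace \<sigma> \<in> C2" "caprini_condition f0 x0 \<delta> \<sigma>" "\<sigma> \<noteq> \<sigma>0" for \<sigma>
      unfolding opt_iff
      using that C2_iff[OF represents_laplace[OF that(1)]]
      by (intro caprini_condition_imp_optimal[OF assms(2) f0 x0 c])
         (auto simp: caprini_condition_def caprini_eq caprini_bound_eq)
    ultimately show ?thesis by blast
  qed
  have "\<delta>m > 0" by (simp add: \<delta>m_def)
  moreover have "(1::real) > 0" by simp
  moreover have "\<forall>\<delta>\<in>{-\<delta>m<..<1}. ?Q \<delta>" by (intro ballI impI) (rule concl)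
  ultimately show ?thesis by blast
qed

end
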